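(* Let $H=(H_n)_{n\ge1}$ be a sequence of graphs with $v(H_n)\le n$ that is sufficiently dense and delocalized. Then the model of $H_n$ planted in $G(n,p)$ exhibits an all-or-nothing (AoN) transition if and only if $$\lim_{n\to\infty}\frac{\psi_q(H_n)}{\psi_{q'}(H_n)}=1\qquad\text{for all }q,q'\in(0,1).$$ Moreover, in this case the critical probability satisfies $p_{\mathrm{AoN}}(n)=(1+o(1))\,\psi_q(H_n)$ as $n\to\infty$, for any $q\in(0,1)$.
   Context: Graphs: $v(J)$ is the number of vertices of $J$; $|J|=e(J)$ is the number of edges. $K_n$ is the complete graph on $n$ vertices. Graphs in $K_n$ are identified with vectors in $\{0,1\}^{\binom n2}$ (edge indicators). Planted model: given $H=H_n$ with $v(H)\le n$, let $\mathcal S$ be the set of copies of $H$ in $K_n$ and $\mathbf P$ the uniform measure on $\mathcal S$. Under $\mathbb P_p$, one observes $\mathbf Y=\mathbf H\cup\mathbf G$, where $\mathbf H\sim\mathbf P$ and $\mathbf G\sim G(n,p)$ is independent of $\mathbf H$. Set $\mathrm{MMSE}_n(p)=\mathbb E_{\mathbb P_p}\big[\|\mathbf H-\mathbb E[\mathbf H\mid\mathbf Y]\|_2^2\big]\in[0,e(H)]$. AoN: the model exhibits an AoN transition at critical probability $p_{\mathrm{AoN}}=p_{\mathrm{AoN}}(n)\in[0,1]$ if for every constant $\epsilon>0$, $\lim_{n\to\infty}\mathrm{MMSE}_n(p)/e(H_n)=1$ for all $p=p_n\in[0,1]$ with $p_n\ge(1+\epsilon)p_{\mathrm{AoN}}(n)$,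 and $\lim_{n\to\infty}\mathrm{MMSE}_n(p)/e(H_n)=0$ for all $p=p_n\in[0,1]$ with $p_n\le(1-\epsilon)p_{\mathrm{AoN}}(n)$. The model exhibits AoN if this holds for some sequence $p_{\mathrm{AoN}}$. Thresholds: for a graph $J$ with at least one edge, $M_J=\frac{n!/(n-v(J))!}{|\mathrm{Aut}(J)|}$ is the number of copies of $J$ in $K_n$, and the first moment threshold is $p_{1M}(J)=M_J^{-1/e(J)}$. For $q\in[0,1]$, $\psi_q(H)=\max\{p_{1M}(J): J\subseteq H,\ |J|\ge\max\{1,q|H|\}\}$. Sufficiently dense: $v(H_n)\to\infty$ and $\frac{e(H_n)}{v(H_n)\log v(H_n)}\to\infty$. Delocalized: let $\alpha_q(H)=\inf\{v(J)/e(J): J\subseteq H,\ |J|\ge\max\{1,q|H|\}\}$. The dense sequence $H$ is delocalized if there exist $0<q\le1$ and $C<\infty$, independent of $n$, such that $\alpha_q(H_n)\le\alpha_0(H_n)+\frac{C}{\log n}$. *)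

theory Defs
  imports
    "HOL-Probability.Probability"
    "HOL-Combinatorics.Permutations"
    "HOL-Library.Landau_Symbols"
begin

section \<open>Finite simple graphs\<close>

text \<open>A graph is a pair of a vertex set and a set of two-element subsets of it; isolated
  vertices are allowed and are counted by \<open>v\<close>.\<close>

type_synonym 'a ugraph = "'a set \<times> 'a set set"

abbreviation verts :: "'a ugraph \<Rightarrow> 'a set" where "verts \<equiv> fst"
abbreviation edges :: "'a ugraph \<Rightarrow> 'a set set" where "edges \<equiv> snd"

definition simple_graph :: "'a ugraph \<Rightarrow> bool" where
  "simple_graph J \<longleftrightarrow> finite (verts J) \<and> edges J \<subseteq> {e. e \<subseteq> verts J \<and> card e = 2}"

definition v :: "'a ugraph \<Rightarrow> nat" where "v J = card (verts J)"
definition e :: "'a ugraph \<Rightarrow> nat" where "e J = card (edges J)"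

definition complete_graph :: "nat \<Rightarrow> nat ugraph" where
  "complete_graph n = ({..<n}, {d. d \<subseteq> {..<n} \<and> card d = 2})"

definition subgraph :: "'a ugraph \<Rightarrow> 'a ugraph \<Rightarrow> bool" where
  "subgraph J H \<longleftrightarrow> simple_graph J \<and> verts J \<subseteq> verts H \<and> edges J \<subseteq> edges H"

definition isomorphic :: "'a ugraph \<Rightarrow> 'b ugraph \<Rightarrow> bool" where
  "isomorphic J H \<longleftrightarrow> (\<exists>f. bij_betw f (verts J) (verts H) \<and> (`) f ` edges J = edges H)"

definition Aut :: "'a ugraph \<Rightarrow> ('a \<Rightarrow> 'a) set" where
  "Aut J = {f. f permutes verts J \<and> (`) f ` edges J = edges J}"

text \<open>Copies are subgraphs of the complete graph, vertex set included. If \<open>H\<close> has isolated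
  vertices, then distinct copies may have the same edge set; every edge set arises from equally
  many copies, so the uniform measure on copies induces the uniform measure on their edge sets.\<close>

definition copies :: "nat \<Rightarrow> 'a ugraph \<Rightarrow> nat ugraph set" where
  "copies n H = {J. subgraph J (complete_graph n) \<and> isomorphic J H}"


section \<open>The planted model\<close>

definition gnp :: "nat \<Rightarrow> real \<Rightarrow> nat set set pmf" where
  "gnp n p = map_pmf (\<lambda>f. {d \<in> edges (complete_graph n). f d})
     (Pi_pmf (edges (complete_graph n)) False (\<lambda>_. bernoulli_pmf p))"

text \<open>The joint law of the planted copy and the independent noise; meaningful if
  \<open>v H \<le> n\<close> (so that copies exist) and \<open>p\<close> lies in the unit interval.\<close>

definition planted :: "nat \<Rightarrow> 'a ugraph \<Rightarrow> real \<Rightarrow> (nat ugraph \<times> nat set set) pmf" where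
  "planted n H p = pair_pmf (pmf_of_set (copies n H)) (gnp n p)"

definition observation :: "nat ugraph \<times> nat set set \<Rightarrow> nat set set" where
  "observation = (\<lambda>(J, G). edges J \<union> G)"

definition sigma_observation :: "(nat ugraph \<times> nat set set) measure" where
  "sigma_observation = vimage_algebra UNIV observation (count_space UNIV)"

definition planted_edge :: "nat set \<Rightarrow> nat ugraph \<times> nat set set \<Rightarrow> real" where
  "planted_edge d = (\<lambda>(J, G). of_bool (d \<in> edges J))"

text \<open>The squared Euclidean norm is the sum over the coordinates, i.e. over the edges of the
  complete graph; the conditional expectation of the indicator vector is taken coordinatewise.\<close>

definition MMSE :: "nat \<Rightarrow> 'a ugraph \<Rightarrow> real \<Rightarrow> real" where
  "MMSE n H p = measure_pmf.expectation (planted n H p) (\<lambda>\<omega>.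
     \<Sum>d\<in>edges (complete_graph n).
       (planted_edge d \<omega>
         - real_cond_exp (measure_pmf (planted n H p)) sigma_observation (planted_edge d) \<omega>)\<^sup>2)"


section \<open>All-or-nothing\<close>

text \<open>The bound imposed on \<open>p n\<close> may be unsatisfiable for some \<open>n\<close>, namely if
  \<open>(1 + \<epsilon>) * pA n > 1\<close>. The limits are therefore taken along those \<open>n\<close> for which the bound
  holds. If it holds for all large \<open>n\<close>, this is the ordinary limit as \<open>n\<close> tends to infinity; if
  it holds for only finitely many \<open>n\<close>, there is no condition. Requiring the bound for all \<open>n\<close>
  instead would let a single index with \<open>pA n = 1\<close> make the first condition vacuous.\<close>

definition AoN_critical :: "(nat \<Rightarrow> 'a ugraph) \<Rightarrow> (nat \<Rightarrow> real) \<Rightarrow> bool" where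
  "AoN_critical H pA \<longleftrightarrow>
     (\<forall>n\<ge>1. pA n \<in> {0..1}) \<and>
     (\<forall>\<epsilon>>0. \<forall>p. (\<forall>n\<ge>1. p n \<in> {0..1}) \<longrightarrow>
        ((\<lambda>n. MMSE n (H n) (p n) / real (e (H n))) \<longlongrightarrow> 1)
          (inf sequentially (principal {n. p n \<ge> (1 + \<epsilon>) * pA n})) \<and>
        ((\<lambda>n. MMSE n (H n) (p n) / real (e (H n))) \<longlongrightarrow> 0)
          (inf sequentially (principal {n. p n \<le> (1 - \<epsilon>) * pA n})))"

definition exhibits_AoN :: "(nat \<Rightarrow> 'a ugraph) \<Rightarrow> bool" where
  "exhibits_AoN H \<longleftrightarrow> (\<exists>pA. AoN_critical H pA)"


section \<open>Thresholds, density and delocalization\<close>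

definition num_copies :: "nat \<Rightarrow> 'a ugraph \<Rightarrow> real" where
  "num_copies n J = fact n / fact (n - v J) / real (card (Aut J))"

definition p_1M :: "nat \<Rightarrow> 'a ugraph \<Rightarrow> real" where
  "p_1M n J = num_copies n J powr (- 1 / real (e J))"

definition large_subgraphs :: "real \<Rightarrow> 'a ugraph \<Rightarrow> 'a ugraph set" where
  "large_subgraphs q H = {J. subgraph J H \<and> real (e J) \<ge> max 1 (q * real (e H))}"

definition \<psi> :: "nat \<Rightarrow> real \<Rightarrow> 'a ugraph \<Rightarrow> real" where
  "\<psi> n q H = Max (p_1M n ` large_subgraphs q H)"

definition \<alpha> :: "real \<Rightarrow> 'a ugraph \<Rightarrow> real" where
  "\<alpha> q H = (INF J\<in>large_subgraphs q H. real (v J) / real (e J))"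

definition sufficiently_dense :: "(nat \<Rightarrow> 'a ugraph) \<Rightarrow> bool" where
  "sufficiently_dense H \<longleftrightarrow>
     filterlim (\<lambda>n. real (v (H n))) at_top sequentially \<and>
     filterlim (\<lambda>n. real (e (H n)) / (real (v (H n)) * ln (real (v (H n))))) at_top sequentially"

text \<open>At \<open>n = 1\<close> the bound \<open>C / log n\<close> is infinite, so that index carries no condition.\<close>

definition delocalized :: "(nat \<Rightarrow> 'a ugraph) \<Rightarrow> bool" where
  "delocalized H \<longleftrightarrow>
     (\<exists>q C. 0 < q \<and> q \<le> 1 \<and> (\<forall>n\<ge>2. \<alpha> q (H n) \<le> \<alpha> 0 (H n) + C / ln (real n)))"

end

theory Submission
  imports Defs
begin

text \<open>Given the observation \<open>y\<close>, the posterior is uniform over the copies of \<open>H\<close> inside \<open>y\<close>. Hence the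
MMSE is the expected value of \<open>e H - card (edges J \<inter> edges J')\<close>, where \<open>J\<close> and \<open>J'\<close> are two replicas,
drawn independently from the posterior (\<open>MMSE_replica\<close>); the pair has the same law as the planted
copy and one posterior sample. Recovery therefore fails if two replicas have a small overlap and
succeeds if their overlap is almost \<open>e H\<close>, and both events are controlled by first moments.

Density makes these moments easy to compute. Since \<open>v ln v\<close> is small compared with \<open>e H\<close>, every
factor \<open>v ^ v\<close>, and with it \<open>fact v\<close>, the order of an automorphism group and the number of ways in
which two vertex sets overlap, is \<open>exp (\<kappa> * e H)\<close> with \<open>\<kappa>\<close> as small as desired. Up to such factors a
subgraph \<open>S\<close> has \<open>n ^ v S\<close> copies, and a copy of \<open>K\<close> meets a given copy of \<open>H\<close> in a given \<open>S\<close> in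
\<open>n ^ (v K - v S)\<close> ways.

Above the threshold, i.e. for \<open>p \<ge> (1 + \<epsilon>) * \<psi>_q\<close>, the number of copies in the observation is at least
\<open>\<delta>\<close> times its null mean, except on an event of planted probability \<open>\<delta>\<close>. Relative to this number, the
copies that share at least \<open>q * e H\<close> edges with the planted one are negligible, because
\<open>\<psi>_q ^ e S * n ^ v S \<ge> 1\<close> for each such intersection \<open>S\<close> by the definition of \<open>\<psi>_q\<close>, and
each edge of \<open>S\<close> gains a factor \<open>1 + \<epsilon>\<close>. So
replicas overlap in fewer than \<open>q * e H\<close> edges (\<open>MMSE_above_threshold\<close>).

Below the threshold, let \<open>K\<close> attain \<open>\<psi>_q\<close> and let \<open>p \<le> (1 - \<epsilon>) * \<psi>_q\<close>. The expected number of copies of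
\<open>K\<close> in the observation that meet the planted copy in \<open>S\<close> is at most about
\<open>(1 - \<epsilon>) ^ (e K - e S) / (\<psi>_q ^ e S * n ^ v S)\<close>. If \<open>\<psi>\<close> is asymptotically constant, the denominator is at
least \<open>exp (- \<eta> * e H)\<close> for an \<open>S\<close> with at least \<open>q' * e H\<close> edges, however small \<open>q'\<close> and \<open>\<eta>\<close> are.
For a smaller \<open>S\<close>, delocalization shows that it is at least \<open>exp (- C * e S - \<eta> * e H)\<close>. So copies of \<open>K\<close> that miss
a positive fraction of it do not occur; letting \<open>q\<close> tend to 1 yields almost full recovery
(\<open>MMSE_below_constant_threshold\<close>). For small fixed \<open>q\<close>, delocalization alone excludes
copies of \<open>K\<close> with a very small overlap, so that MMSE / e H stays away from 1
(\<open>MMSE_below_threshold_nontrivial\<close>).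

If \<open>\<psi>\<close> is asymptotically constant, these bounds show that it is critical. Conversely, let \<open>pA\<close> be
critical. A \<open>pA\<close> well above \<open>\<psi>_q\<close> would contradict the failure of recovery between the two, and a \<open>pA\<close>
well below \<open>\<psi>_q\<close> with small \<open>q\<close> would contradict the nontrivial recovery between the two. As
\<open>\<psi>_q\<close> decreases in \<open>q\<close>, the ratio of \<open>pA\<close> to \<open>\<psi>_q\<close> tends to 1 for every \<open>q\<close>, and so \<open>\<psi>\<close> is asymptotically
constant.\<close>

section \<open>The posterior and the replica formula for the MMSE\<close>

lemma edges_complete_graph_finite: "finite (edges (complete_graph n))"
  by (rule finite_subset[of _ "Pow {..<n}"]) (auto simp: complete_graph_def)

text \<open>The noise is unconstrained on \<open>T\<close>, where it is absorbed, and it is determined by \<open>y\<close> elsewhere.\<close>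

lemma pmf_gnp_union:
  assumes p: "p \<in> {0..1}" and T: "T \<subseteq> edges (complete_graph n)"
  shows "pmf (map_pmf (\<lambda>G. T \<union> G) (gnp n p)) y =
    (if T \<subseteq> y \<and> y \<subseteq> edges (complete_graph n)
     then p ^ (card y - card T) * (1 - p) ^ (card (edges (complete_graph n)) - card y) else 0)"
proof -
  let ?E = "edges (complete_graph n)"
  let ?M = "Pi_pmf ?E False (\<lambda>_. bernoulli_pmf p)"
  have fin: "finite ?E" by (rule edges_complete_graph_finite)
  have *: "pmf (map_pmf (\<lambda>G. T \<union> G) (gnp n p)) y
      = measure_pmf.prob ?M {f. T \<union> {d \<in> ?E. f d} = y}"
    unfolding gnp_def map_pmf_comp pmf_map vimage_def by simp
  show ?thesis
  proof (cases "T \<subseteq> y \<and> y \<subseteq> ?E")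
    case True
    let ?B = "\<lambda>d. if d \<in> T then UNIV else if d \<in> y then {True} else {False}"
    have set_eq: "{f. T \<union> {d \<in> ?E. f d} = y} = Pi ?E ?B"
    proof (intro set_eqI iffI)
      fix f assume "f \<in> {f. T \<union> {d \<in> ?E. f d} = y}"
      then show "f \<in> Pi ?E ?B" by auto
    next
      fix f assume f: "f \<in> Pi ?E ?B"
      have "f d \<longleftrightarrow> d \<in> y" if "d \<in> ?E" "d \<notin> T" for d
        using Pi_mem[OF f that(1)] that(2) by (cases "d \<in> y") auto
      then show "f \<in> {f. T \<union> {d \<in> ?E. f d} = y}" using True by blast
    qed
    have "measure_pmf.prob ?M (Pi ?E ?B) = (\<Prod>d\<in>?E. measure_pmf.prob (bernoulli_pmf p) (?B d))"
      by (rule measure_Pi_pmf_Pi[OF fin])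
    also have "\<dots> = (\<Prod>d\<in>?E. (if d \<in> y then if d \<in> T then 1 else p else 1 - p))"
      using p True by (intro prod.cong refl) (auto simp: measure_pmf_single)
    also have "\<dots> = (\<Prod>d\<in>y. if d \<in> T then 1 else p) * (1 - p) ^ card (?E - y)"
    proof -
      have "?E \<inter> {d. d \<in> y} = y" "?E \<inter> - {d. d \<in> y} = ?E - y" using True by auto
      then show ?thesis using fin by (subst prod.If_cases) auto
    qed
    also have "(\<Prod>d\<in>y. if d \<in> T then 1 else p) = p ^ card (y - T)"
    proof -
      have "y \<inter> - {d. d \<in> T} = y - T" by auto
      then show ?thesis using finite_subset[of y ?E] True fin by (subst prod.If_cases) auto
    qed
    finally have "measure_pmf.prob ?M (Pi ?E ?B) = p ^ card (y - T) * (1 - p) ^ card (?E - y)" .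
    moreover have "card (y - T) = card y - card T" "card (?E - y) = card ?E - card y"
      using True T finite_subset[OF _ fin] by (auto intro!: card_Diff_subset)
    ultimately show ?thesis using True * set_eq by simp
  next
    case False
    then have "{f. T \<union> {d \<in> ?E. f d} = y} = {}" using T by auto
    then show ?thesis unfolding * if_not_P[OF False] by simp
  qed
qed

text \<open>The joint probability of a planted copy and the observation \<open>y\<close>. It is the same for all
copies contained in \<open>y\<close>, which is why the posterior is uniform on them.\<close>

definition obs_weight :: "nat \<Rightarrow> 'a ugraph \<Rightarrow> real \<Rightarrow> nat set set \<Rightarrow> real" where
  "obs_weight n H p y = p ^ (card y - e H) *
     (1 - p) ^ (card (edges (complete_graph n)) - card y) / real (card (copies n H))"

lemma finite_copies: "finite (copies n H)"
proof (rule finite_subset)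
  show "copies n H \<subseteq> Pow {..<n} \<times> Pow (edges (complete_graph n))"
    by (auto simp: copies_def subgraph_def complete_graph_def)
qed (simp add: edges_complete_graph_finite)

lemma copies_edges:
  assumes "J \<in> copies n H"
  shows "edges J \<subseteq> edges (complete_graph n)" "card (edges J) = e H" "finite (edges J)"
proof -
  have 1: "edges J \<subseteq> edges (complete_graph n)" "simple_graph J"
    using assms by (auto simp: copies_def subgraph_def)
  then show "edges J \<subseteq> edges (complete_graph n)" by blast
  show "finite (edges J)" using 1 edges_complete_graph_finite finite_subset by blast
  obtain f where f: "bij_betw f (verts J) (verts H)" "(`) f ` edges J = edges H"
    using assms by (auto simp: copies_def isomorphic_def)
  have "inj_on ((`) f) (edges J)"
  proof (rule inj_on_subset)
    show "inj_on ((`) f) (Pow (verts J))" using f(1) inj_on_image_Pow bij_betw_imp_inj_on by blast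
    show "edges J \<subseteq> Pow (verts J)" using 1(2) by (auto simp: simple_graph_def)
  qed
  then show "card (edges J) = e H" using f(2) by (metis card_image e_def)
qed

lemma expectation_planted:
  assumes p: "p \<in> {0..1}" and ne: "copies n H \<noteq> {}"
  shows "measure_pmf.expectation (planted n H p) (\<lambda>\<omega>. \<phi> (fst \<omega>) (observation \<omega>)) =
    (\<Sum>J\<in>copies n H. \<Sum>y\<in>Pow (edges (complete_graph n)).
       of_bool (edges J \<subseteq> y) * obs_weight n H p y * \<phi> J y)"
proof -
  let ?E = "edges (complete_graph n)" and ?C = "copies n H"
  let ?D = "map_pmf (\<lambda>\<omega>. (fst \<omega>, observation \<omega>)) (planted n H p)"
  have D: "?D = pmf_of_set ?C \<bind> (\<lambda>J. map_pmf (\<lambda>y. (J, y)) (map_pmf (\<lambda>G. edges J \<union> G) (gnp n p)))"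
    unfolding planted_def pair_pmf_def observation_def map_bind_pmf map_pmf_comp
    by (simp add: map_pmf_def bind_assoc_pmf bind_return_pmf)
  have pmfD: "pmf ?D (J, y) = of_bool (edges J \<subseteq> y) * obs_weight n H p y"
    if J: "J \<in> ?C" and y: "y \<subseteq> ?E" for J y
  proof -
    have "pmf ?D (J, y) = (\<Sum>J'\<in>?C. pmf (map_pmf (\<lambda>y. (J', y)) (map_pmf (\<lambda>G. edges J' \<union> G) (gnp n p))) (J, y))
       / real (card ?C)"
      unfolding D by (rule pmf_bind_pmf_of_set[OF ne finite_copies])
    also have "(\<Sum>J'\<in>?C. pmf (map_pmf (\<lambda>y. (J', y)) (map_pmf (\<lambda>G. edges J' \<union> G) (gnp n p))) (J, y))
       = (\<Sum>J'\<in>?C. if J' = J then pmf (map_pmf (\<lambda>G. edges J \<union> G) (gnp n p)) y else 0)"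
    proof (intro sum.cong refl)
      fix J' assume "J' \<in> ?C"
      show "pmf (map_pmf (\<lambda>y. (J', y)) (map_pmf (\<lambda>G. edges J' \<union> G) (gnp n p))) (J, y)
        = (if J' = J then pmf (map_pmf (\<lambda>G. edges J \<union> G) (gnp n p)) y else 0)"
      proof (cases "J' = J")
        case True
        have "inj (Pair J)" by (simp add: inj_on_def)
        from pmf_map_inj'[OF this] show ?thesis using True by simp
      next
        case False
        then show ?thesis by (auto simp: pmf_eq_0_set_pmf)
      qed
    qed
    also have "\<dots> = pmf (map_pmf (\<lambda>G. edges J \<union> G) (gnp n p)) y"
      using J by (simp add: finite_copies)
    finally show ?thesis
      using y pmf_gnp_union[OF p copies_edges(1)[OF J]] copies_edges(2)[OF J]
      by (simp add: obs_weight_def)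
  qed
  have "set_pmf ?D \<subseteq> ?C \<times> Pow ?E"
  proof -
    have "set_pmf (gnp n p) \<subseteq> Pow ?E" by (auto simp: gnp_def)
    then show ?thesis
      using copies_edges(1)[where H = H] unfolding D
      by (force simp: set_pmf_of_set[OF ne finite_copies])
  qed
  then have "measure_pmf.expectation ?D (\<lambda>(J, y). \<phi> J y)
      = (\<Sum>x\<in>?C \<times> Pow ?E. (\<lambda>(J, y). \<phi> J y) x * pmf ?D x)"
    by (intro integral_measure_pmf_real)
      (auto simp: finite_copies edges_complete_graph_finite)
  also have "\<dots> = (\<Sum>x\<in>?C \<times> Pow ?E. (\<lambda>(J, y). of_bool (edges J \<subseteq> y) * obs_weight n H p y * \<phi> J y) x)"
    using pmfD by (intro sum.cong refl) auto
  finally show ?thesis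
    by (simp add: sum.cartesian_product split_def)
qed


definition copies_in :: "nat \<Rightarrow> 'a ugraph \<Rightarrow> nat set set \<Rightarrow> nat ugraph set" where
  "copies_in n H y = {J \<in> copies n H. edges J \<subseteq> y}"

definition posterior_edge :: "nat \<Rightarrow> 'a ugraph \<Rightarrow> nat set set \<Rightarrow> nat set \<Rightarrow> real" where
  "posterior_edge n H y d =
     real (card {J \<in> copies_in n H y. d \<in> edges J}) / real (card (copies_in n H y))"

text \<open>The joint law of two independent posterior samples: the observation has
probability \<open>obs_weight n H p y * card (copies_in n H y)\<close>, and each sample then has probability
\<open>1 / card (copies_in n H y)\<close>.\<close>

definition replica_weight :: "nat \<Rightarrow> 'a ugraph \<Rightarrow> real \<Rightarrow> nat ugraph \<Rightarrow> nat ugraph \<Rightarrow> real" where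
  "replica_weight n H p J J' = (\<Sum>y\<in>Pow (edges (complete_graph n)).
     of_bool (edges J \<subseteq> y \<and> edges J' \<subseteq> y) * obs_weight n H p y / real (card (copies_in n H y)))"

lemma finite_copies_in: "finite (copies_in n H y)"
  by (simp add: copies_in_def finite_copies)

lemma sum_copies_of_bool:
  "(\<Sum>J\<in>copies n H. of_bool (edges J \<subseteq> y) * g J) = (\<Sum>J\<in>copies_in n H y. g J :: real)"
  unfolding copies_in_def
  by (intro sum.mono_neutral_cong_right) (auto simp: finite_copies)

text \<open>Under the joint law the copies inside \<open>y\<close> all have weight \<open>obs_weight\<close>, so averaging the edge
indicator over them is the conditional expectation.\<close>

lemma cond_exp_planted_edge:
  assumes p: "p \<in> {0..1}" and ne: "copies n H \<noteq> {}"
  shows "AE \<omega> in measure_pmf (planted n H p).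
    real_cond_exp (measure_pmf (planted n H p)) sigma_observation (planted_edge d) \<omega>
      = posterior_edge n H (observation \<omega>) d"
proof -
  let ?M = "measure_pmf (planted n H p)" and ?E = "edges (complete_graph n)"
  interpret finite_measure_subalgebra ?M sigma_observation
    by unfold_locales (simp add: subalgebra_def sigma_observation_def)
  have fin: "finite (set_pmf (planted n H p))"
  proof (rule finite_subset)
    show "set_pmf (planted n H p) \<subseteq> copies n H \<times> Pow ?E"
      by (auto simp: planted_def gnp_def set_pmf_of_set[OF ne finite_copies])
  qed (simp add: finite_copies edges_complete_graph_finite)
  show ?thesis
  proof (rule real_cond_exp_charact)
    fix A assume "A \<in> sets sigma_observation"
    then obtain B where A: "A = observation -` B"
      unfolding sigma_observation_def by (subst (asm) sets_vimage_algebra2) auto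
    have ind: "indicator A \<omega> = (of_bool (observation \<omega> \<in> B) :: real)" for \<omega>
      by (simp add: A indicator_def)
    have "(\<integral>\<omega>\<in>A. planted_edge d \<omega> \<partial>?M)
      = measure_pmf.expectation (planted n H p)
          (\<lambda>\<omega>. of_bool (observation \<omega> \<in> B) * of_bool (d \<in> edges (fst \<omega>)))"
      unfolding set_lebesgue_integral_def ind
      by (simp add: planted_edge_def split_def)
    also have "\<dots> = (\<Sum>J\<in>copies n H. \<Sum>y\<in>Pow ?E.
       of_bool (edges J \<subseteq> y) * obs_weight n H p y * (of_bool (y \<in> B) * of_bool (d \<in> edges J)))"
      by (rule expectation_planted[OF p ne, where \<phi> = "\<lambda>J y. of_bool (y \<in> B) * of_bool (d \<in> edges J)"])
    also have "\<dots> = (\<Sum>y\<in>Pow ?E. obs_weight n H p y * of_bool (y \<in> B) *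
       (\<Sum>J\<in>copies n H. of_bool (edges J \<subseteq> y) * of_bool (d \<in> edges J)))"
      by (subst sum.swap) (simp add: sum_distrib_left algebra_simps)
    also have "\<dots> = (\<Sum>y\<in>Pow ?E. obs_weight n H p y * of_bool (y \<in> B) *
       (\<Sum>J\<in>copies n H. of_bool (edges J \<subseteq> y) * posterior_edge n H y d))"
    proof (rule sum.cong[OF refl], rule arg_cong2[where f = "(*)", OF refl])
      fix y
      have "(\<Sum>J\<in>copies_in n H y. of_bool (d \<in> edges J)) = real (card {J \<in> copies_in n H y. d \<in> edges J})"
        by (simp add: sum_of_bool_eq finite_copies_in Int_def)
      also have "\<dots> = (\<Sum>J\<in>copies_in n H y. posterior_edge n H y d)"
        using finite_copies_in[of n H y] by (auto simp: posterior_edge_def card_eq_0_iff)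
      finally show "(\<Sum>J\<in>copies n H. of_bool (edges J \<subseteq> y) * of_bool (d \<in> edges J)) =
         (\<Sum>J\<in>copies n H. of_bool (edges J \<subseteq> y) * posterior_edge n H y d)"
        by (simp only: sum_copies_of_bool)
    qed
    also have "\<dots> = (\<Sum>J\<in>copies n H. \<Sum>y\<in>Pow ?E.
       of_bool (edges J \<subseteq> y) * obs_weight n H p y * (of_bool (y \<in> B) * posterior_edge n H y d))"
      by (subst sum.swap) (simp add: sum_distrib_left algebra_simps)
    also have "\<dots> = measure_pmf.expectation (planted n H p)
          (\<lambda>\<omega>. of_bool (observation \<omega> \<in> B) * posterior_edge n H (observation \<omega>) d)"
      by (rule expectation_planted[OF p ne, where \<phi> = "\<lambda>J y. of_bool (y \<in> B) * posterior_edge n H y d", symmetric])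
    also have "\<dots> = (\<integral>\<omega>\<in>A. posterior_edge n H (observation \<omega>) d \<partial>?M)"
      unfolding set_lebesgue_integral_def ind by simp
    finally show "(\<integral>\<omega>\<in>A. planted_edge d \<omega> \<partial>?M) = (\<integral>\<omega>\<in>A. posterior_edge n H (observation \<omega>) d \<partial>?M)" .
  next
    have "observation \<in> sigma_observation \<rightarrow>\<^sub>M count_space UNIV"
      unfolding sigma_observation_def by (rule measurable_vimage_algebra1) auto
    from measurable_compose[OF this, of "\<lambda>y. posterior_edge n H y d" borel]
    show "(\<lambda>\<omega>. posterior_edge n H (observation \<omega>) d) \<in> borel_measurable sigma_observation"
      by simp
  qed (auto intro: integrable_measure_pmf_finite[OF fin])
qed

text \<open>Conditionally on \<open>y\<close>, the error is the sum over the edges \<open>d\<close> of the variances of the indicators of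
\<open>d\<close>. The square of the posterior probability of \<open>d\<close> is the probability that two replicas both
contain \<open>d\<close>; its sum over \<open>d\<close> is their expected overlap.\<close>

lemma MMSE_replica:
  assumes p: "p \<in> {0..1}" and ne: "copies n H \<noteq> {}"
  shows "MMSE n H p = (\<Sum>J\<in>copies n H. \<Sum>J'\<in>copies n H.
    replica_weight n H p J J' * (real (e H) - real (card (edges J \<inter> edges J'))))"
proof -
  let ?E = "edges (complete_graph n)" and ?C = "copies n H"
  let ?h = "posterior_edge n H" and ?w = "obs_weight n H p"
  have "MMSE n H p = measure_pmf.expectation (planted n H p) (\<lambda>\<omega>.
     \<Sum>d\<in>?E. (of_bool (d \<in> edges (fst \<omega>)) - ?h (observation \<omega>) d)\<^sup>2)"
    unfolding MMSE_def
  proof (rule integral_cong_AE)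
    have "AE \<omega> in measure_pmf (planted n H p). \<forall>d\<in>?E.
      real_cond_exp (measure_pmf (planted n H p)) sigma_observation (planted_edge d) \<omega>
      = ?h (observation \<omega>) d"
      by (intro AE_finite_allI edges_complete_graph_finite cond_exp_planted_edge assms)
    then show "AE \<omega> in measure_pmf (planted n H p).
       (\<Sum>d\<in>?E. (planted_edge d \<omega> - real_cond_exp (measure_pmf (planted n H p)) sigma_observation (planted_edge d) \<omega>)\<^sup>2)
       = (\<Sum>d\<in>?E. (of_bool (d \<in> edges (fst \<omega>)) - ?h (observation \<omega>) d)\<^sup>2)"
      by eventually_elim (auto simp: planted_edge_def split_def intro!: sum.cong)
  qed auto
  also have "\<dots> = (\<Sum>J\<in>?C. \<Sum>y\<in>Pow ?E. of_bool (edges J \<subseteq> y) * ?w y *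
     (\<Sum>d\<in>?E. (of_bool (d \<in> edges J) - ?h y d)\<^sup>2))"
    by (rule expectation_planted[OF assms, where \<phi> = "\<lambda>J y. \<Sum>d\<in>?E. (of_bool (d \<in> edges J) - ?h y d)\<^sup>2"])
  also have "\<dots> = (\<Sum>y\<in>Pow ?E. ?w y * (\<Sum>J\<in>?C. of_bool (edges J \<subseteq> y) *
     (\<Sum>d\<in>?E. (of_bool (d \<in> edges J) - ?h y d)\<^sup>2)))"
    by (subst sum.swap) (simp add: sum_distrib_left mult_ac)
  also have "\<dots> = (\<Sum>y\<in>Pow ?E. ?w y * ((\<Sum>J\<in>?C. of_bool (edges J \<subseteq> y) * (\<Sum>J'\<in>?C. of_bool (edges J' \<subseteq> y) *
     (real (e H) - real (card (edges J \<inter> edges J'))))) / real (card (copies_in n H y))))"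
  proof (rule sum.cong[OF refl], rule arg_cong2[where f = "(*)", OF refl])
    fix y assume y: "y \<in> Pow ?E"
    let ?Cy = "copies_in n H y" and ?Z = "real (card (copies_in n H y))"
    let ?Zd = "\<lambda>d. (\<Sum>J\<in>?Cy. of_bool (d \<in> edges J) :: real)"
    have sub: "edges J \<subseteq> ?E" if "J \<in> ?Cy" for J
      using that copies_edges(1)[where H = H] by (auto simp: copies_in_def)
    have h: "?h y d = ?Zd d / ?Z" for d
      by (simp add: posterior_edge_def sum_of_bool_eq finite_copies_in Int_def)
    have inter: "real (card (edges J \<inter> edges J')) = (\<Sum>d\<in>?E. of_bool (d \<in> edges J) * of_bool (d \<in> edges J'))"
      if "J \<in> ?Cy" for J J'
    proof -
      have "?E \<inter> {d. d \<in> edges J \<and> d \<in> edges J'} = edges J \<inter> edges J'" using sub[OF that] by auto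
      then have "real (card (edges J \<inter> edges J')) = (\<Sum>d\<in>?E. of_bool (d \<in> edges J \<and> d \<in> edges J'))"
        by (simp add: edges_complete_graph_finite)
      then show ?thesis by (simp only: of_bool_conj)
    qed
    have tot: "(\<Sum>d\<in>?E. ?Zd d) = ?Z * real (e H)"
    proof -
      have "(\<Sum>d\<in>?E. ?Zd d) = (\<Sum>J\<in>?Cy. \<Sum>d\<in>?E. of_bool (d \<in> edges J))" by (rule sum.swap)
      also have "\<dots> = (\<Sum>J\<in>?Cy. real (e H))"
      proof (intro sum.cong refl)
        fix J assume J: "J \<in> ?Cy"
        have "(\<Sum>d\<in>?E. of_bool (d \<in> edges J)) = real (card (edges J \<inter> edges J))"
          unfolding inter[OF J] by (intro sum.cong) auto
        then show "(\<Sum>d\<in>?E. of_bool (d \<in> edges J)) = real (e H)"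
          using J copies_edges(2)[of J n H] by (simp add: copies_in_def)
      qed
      finally show ?thesis by simp
    qed
    have "(\<Sum>J\<in>?C. of_bool (edges J \<subseteq> y) * (\<Sum>d\<in>?E. (of_bool (d \<in> edges J) - ?h y d)\<^sup>2))
      = (\<Sum>d\<in>?E. \<Sum>J\<in>?Cy. (of_bool (d \<in> edges J) - ?h y d)\<^sup>2)"
      unfolding sum_copies_of_bool by (rule sum.swap)
    also have "\<dots> = (\<Sum>d\<in>?E. ?Zd d - ?Zd d * ?Zd d / ?Z)"
    proof (intro sum.cong refl)
      fix d
      have "(\<Sum>J\<in>?Cy. (of_bool (d \<in> edges J) - ?h y d)\<^sup>2)
        = (\<Sum>J\<in>?Cy. of_bool (d \<in> edges J) - 2 * ?h y d * of_bool (d \<in> edges J) + (?h y d)\<^sup>2)"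
        by (intro sum.cong refl) (auto simp: power2_eq_square algebra_simps)
      also have "\<dots> = ?Zd d - 2 * ?h y d * ?Zd d + ?Z * (?h y d)\<^sup>2"
        by (simp only: sum.distrib sum_subtractf sum_distrib_left[symmetric] sum_constant)
      also have "\<dots> = ?Zd d - ?Zd d * ?Zd d / ?Z"
        unfolding h by (cases "?Z = 0") (simp_all add: field_simps power2_eq_square)
      finally show "(\<Sum>J\<in>?Cy. (of_bool (d \<in> edges J) - ?h y d)\<^sup>2) = ?Zd d - ?Zd d * ?Zd d / ?Z" .
    qed
    also have "\<dots> = ?Z * real (e H) - (\<Sum>d\<in>?E. ?Zd d * ?Zd d) / ?Z"
      by (simp add: sum_subtractf tot sum_divide_distrib)
    also have "\<dots> = (\<Sum>J\<in>?Cy. \<Sum>J'\<in>?Cy. real (e H) - real (card (edges J \<inter> edges J'))) / ?Z"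
    proof -
      have "(\<Sum>d\<in>?E. ?Zd d * ?Zd d) = (\<Sum>d\<in>?E. \<Sum>J\<in>?Cy. \<Sum>J'\<in>?Cy. of_bool (d \<in> edges J) * of_bool (d \<in> edges J'))"
        by (simp add: sum_product)
      also have "\<dots> = (\<Sum>J\<in>?Cy. \<Sum>d\<in>?E. \<Sum>J'\<in>?Cy. of_bool (d \<in> edges J) * of_bool (d \<in> edges J'))"
        by (rule sum.swap)
      also have "\<dots> = (\<Sum>J\<in>?Cy. \<Sum>J'\<in>?Cy. \<Sum>d\<in>?E. of_bool (d \<in> edges J) * of_bool (d \<in> edges J'))"
        by (intro sum.cong refl sum.swap)
      also have "\<dots> = (\<Sum>J\<in>?Cy. \<Sum>J'\<in>?Cy. real (card (edges J \<inter> edges J')))"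
        using inter by (intro sum.cong refl) auto
      finally show ?thesis
        by (cases "?Z = 0") (simp_all add: sum_subtractf field_simps)
    qed
    finally show "(\<Sum>J\<in>?C. of_bool (edges J \<subseteq> y) * (\<Sum>d\<in>?E. (of_bool (d \<in> edges J) - ?h y d)\<^sup>2))
      = (\<Sum>J\<in>?C. of_bool (edges J \<subseteq> y) * (\<Sum>J'\<in>?C. of_bool (edges J' \<subseteq> y) *
         (real (e H) - real (card (edges J \<inter> edges J'))))) / ?Z"
      by (simp only: sum_copies_of_bool)
  qed
  also have "\<dots> = (\<Sum>y\<in>Pow ?E. \<Sum>J\<in>?C. \<Sum>J'\<in>?C. of_bool (edges J \<subseteq> y \<and> edges J' \<subseteq> y) * ?w y
     / real (card (copies_in n H y)) * (real (e H) - real (card (edges J \<inter> edges J'))))"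
    by (simp add: sum_distrib_left sum_divide_distrib of_bool_conj mult_ac)
  also have "\<dots> = (\<Sum>J\<in>?C. \<Sum>y\<in>Pow ?E. \<Sum>J'\<in>?C. of_bool (edges J \<subseteq> y \<and> edges J' \<subseteq> y) * ?w y
     / real (card (copies_in n H y)) * (real (e H) - real (card (edges J \<inter> edges J'))))"
    by (rule sum.swap)
  also have "\<dots> = (\<Sum>J\<in>?C. \<Sum>J'\<in>?C. \<Sum>y\<in>Pow ?E. of_bool (edges J \<subseteq> y \<and> edges J' \<subseteq> y) * ?w y
     / real (card (copies_in n H y)) * (real (e H) - real (card (edges J \<inter> edges J'))))"
    by (intro sum.cong refl sum.swap)
  finally show ?thesis
    unfolding replica_weight_def by (simp only: sum_distrib_right)
qed

section \<open>Counting labelled copies\<close>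

text \<open>Labelled copies are easier to count than copies: they are injections, and each copy arises from
at least one and at most \<open>v H ^ v H\<close> of them. The latter factor is harmless for dense graphs, so
that no exact orbit count is needed.\<close>

definition injections :: "'a set \<Rightarrow> nat \<Rightarrow> ('a \<Rightarrow> nat) set" where
  "injections V n = {f \<in> V \<rightarrow>\<^sub>E {..<n}. inj_on f V}"

definition image_graph :: "('a \<Rightarrow> 'b) \<Rightarrow> 'a ugraph \<Rightarrow> 'b ugraph" where
  "image_graph f J = (f ` verts J, (`) f ` edges J)"

lemma finite_injections: "finite V \<Longrightarrow> finite (injections V n)"
  unfolding injections_def by (rule finite_subset[of _ "V \<rightarrow>\<^sub>E {..<n}"]) (auto intro: finite_PiE)

lemma simple_graphD:
  assumes "simple_graph J"
  shows "finite (verts J)" "finite (edges J)" "edges J \<subseteq> Pow (verts J)"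
  using assms finite_subset[of "edges J" "Pow (verts J)"] by (auto simp: simple_graph_def)

lemma image_graph_in_copies:
  assumes H: "simple_graph H" and f: "f \<in> injections (verts H) n"
  shows "image_graph f H \<in> copies n H"
proof -
  have inj: "inj_on f (verts H)" and fn: "f ` verts H \<subseteq> {..<n}"
    using f by (auto simp: injections_def PiE_def Pi_def)
  have 1: "f ` d \<subseteq> f ` verts H \<and> card (f ` d) = 2" if "d \<in> edges H" for d
    using that H card_image[OF inj_on_subset[OF inj, of d]] by (auto simp: simple_graph_def)
  let ?g = "inv_into (verts H) f"
  have "bij_betw ?g (f ` verts H) (verts H)"
    using inj by (simp add: bij_betw_inv_into inj_on_imp_bij_betw)
  moreover have "(`) ?g ` ((`) f ` edges H) = edges H"
  proof -
    have "?g ` f ` d = d" if "d \<in> edges H" for d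
      using that simple_graphD(3)[OF H] inj by (meson inv_into_image_cancel PowD subsetD)
    then show ?thesis by (force simp: image_image)
  qed
  ultimately show ?thesis
    using 1 fn simple_graphD(1)[OF H]
    by (fastforce simp: copies_def subgraph_def image_graph_def complete_graph_def isomorphic_def simple_graph_def)
qed

lemma copy_is_image_graph:
  assumes J: "J \<in> copies n H" and H: "simple_graph H"
  obtains f where "f \<in> injections (verts H) n" "J = image_graph f H"
proof -
  obtain g where g: "bij_betw g (verts J) (verts H)" "(`) g ` edges J = edges H"
    and sJ: "simple_graph J" and Jn: "verts J \<subseteq> {..<n}"
    using J by (auto simp: copies_def subgraph_def isomorphic_def complete_graph_def)
  let ?i = "inv_into (verts J) g"
  let ?f = "restrict ?i (verts H)"
  have bij: "bij_betw ?i (verts H) (verts J)" by (rule bij_betw_inv_into[OF g(1)])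
  have "?f \<in> injections (verts H) n"
    using bij Jn by (auto simp: injections_def bij_betw_def inj_on_def)
  moreover have "?f ` verts H = verts J" using bij by (simp add: bij_betw_def)
  moreover have "(`) ?f ` edges H = edges J"
  proof -
    have "?f ` g ` d = d" if "d \<in> edges J" for d
    proof -
      have d: "d \<subseteq> verts J" using that simple_graphD(3)[OF sJ] by auto
      then have "g ` d \<subseteq> verts H" using g(1) by (auto simp: bij_betw_def)
      then have "?f ` g ` d = ?i ` g ` d" by (intro image_cong) auto
      also have "\<dots> = d" using d g(1) by (simp add: bij_betw_def inv_into_image_cancel)
      finally show ?thesis .
    qed
    then show ?thesis unfolding g(2)[symmetric] by (force simp: image_image)
  qed
  ultimately show ?thesis using that[of ?f] by (simp add: image_graph_def)
qed

lemma copies_eq_image: "simple_graph H \<Longrightarrow> copies n H = (\<lambda>f. image_graph f H) ` injections (verts H) n"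
  using image_graph_in_copies copy_is_image_graph by blast

lemma falling_factorial_lower:
  assumes "k \<le> (n::nat)"
  shows "n ^ k \<le> (\<Prod>i<k. n - i) * k ^ k"
proof -
  have "n \<le> (n - i) * k" if "i < k" for i
  proof -
    define l where "l = n - i"
    define j where "j = k - 1"
    have l: "n = i + l" "l \<ge> 1" and j: "k = Suc j" "i \<le> j"
      using assms that by (auto simp: l_def j_def)
    have "i \<le> l * j" using l j by (metis le_trans mult_le_mono1 nat_mult_1)
    then show ?thesis using l j by simp
  qed
  then have "(\<Prod>i<k. n) \<le> (\<Prod>i<k. (n - i) * k)" by (intro prod_mono) auto
  then show ?thesis by (simp add: prod.distrib)
qed

lemma fact_falling_factorial: "k \<le> n \<Longrightarrow> fact n = fact (n - k) * (\<Prod>i<k. n - i)"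
proof (induction k)
  case (Suc k)
  then have "fact (n - k) = (n - k) * fact (n - Suc k)"
    by (metis Suc_diff_Suc Suc_le_lessD fact_Suc of_nat_id)
  then show ?case using Suc by (simp add: mult_ac)
qed simp

lemma card_copies_lower:
  assumes H: "simple_graph H" and le: "v H \<le> n"
  shows "real n ^ v H \<le> real (card (copies n H)) * real (v H) ^ (2 * v H)"
proof -
  let ?V = "verts H" and ?I = "injections (verts H) n"
  have finV: "finite ?V" by (rule simple_graphD[OF H])
  have "card ?I = (\<Prod>i<v H. n - i)"
    unfolding injections_def using card_inj_on_subset_funcset[OF finV finite_lessThan, of ?V n]
    by (simp add: v_def atLeast0LessThan)
  then have 1: "n ^ v H \<le> card ?I * v H ^ v H" using falling_factorial_lower[OF le] by simp
  have "card ?I = (\<Sum>J\<in>copies n H. card {f \<in> ?I. image_graph f H = J})"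
    unfolding copies_eq_image[OF H]
    using sum.image_gen[of ?I "\<lambda>_. 1::nat" "\<lambda>f. image_graph f H"] finite_injections[OF finV]
    by simp
  also have "\<dots> \<le> (\<Sum>J\<in>copies n H. v H ^ v H)"
  proof (rule sum_mono)
    fix J assume "J \<in> copies n H"
    then obtain f where f: "f \<in> ?I" "J = image_graph f H" by (rule copy_is_image_graph[OF _ H])
    have fin: "finite (verts J)" using f finV by (simp add: image_graph_def)
    have "card {f \<in> ?I. image_graph f H = J} \<le> card (?V \<rightarrow>\<^sub>E verts J)"
      using finV fin by (intro card_mono finite_PiE) (auto simp: injections_def image_graph_def)
    also have "\<dots> = v H ^ v H"
    proof -
      have "card (verts J) = v H" using f by (simp add: image_graph_def injections_def card_image v_def)
      then show ?thesis using finV by (simp add: card_PiE v_def)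
    qed
    finally show "card {f \<in> ?I. image_graph f H = J} \<le> v H ^ v H" .
  qed
  finally have "card ?I \<le> card (copies n H) * v H ^ v H" by simp
  then have "n ^ v H \<le> card (copies n H) * v H ^ v H * v H ^ v H"
    using 1 by (meson le_trans mult_le_mono1)
  then have "n ^ v H \<le> card (copies n H) * v H ^ (2 * v H)"
    by (simp add: mult_2 power_add mult.assoc)
  then have "real (n ^ v H) \<le> real (card (copies n H) * v H ^ (2 * v H))" by (simp only: of_nat_le_iff)
  then show ?thesis by simp
qed

lemma copies_nonempty:
  assumes H: "simple_graph H" and le: "v H \<le> n"
  shows "copies n H \<noteq> {}"
proof -
  obtain f where "inj_on f (verts H)" "f ` verts H \<subseteq> {..<n}"
    using inj_on_iff_card_le[of "verts H" "{..<n}"] le simple_graphD[OF H] by (auto simp: v_def)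
  then have "restrict f (verts H) \<in> injections (verts H) n" by (auto simp: injections_def inj_on_def)
  then show ?thesis using image_graph_in_copies[OF H] by blast
qed

text \<open>Give a vertex the weight \<open>n\<close> if it is sent into \<open>U\<close> and 1 otherwise. The weight of a map
is a product over the vertices, so the sum over all maps factorizes. The result says that a map
which hits \<open>U\<close> in \<open>a\<close> vertices is about \<open>n ^ a\<close> times rarer than a generic one.\<close>

lemma sum_over_hits:
  assumes V: "finite V" and U: "U \<subseteq> {..<n}"
  shows "(\<Sum>f\<in>injections V n. real n ^ card {x \<in> V. f x \<in> U}) \<le> (real n * (real (card U) + 1)) ^ card V"
proof -
  have "(\<Sum>f\<in>injections V n. real n ^ card {x \<in> V. f x \<in> U})
     \<le> (\<Sum>f\<in>V \<rightarrow>\<^sub>E {..<n}. real n ^ card {x \<in> V. f x \<in> U})"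
    using V by (intro sum_mono2 finite_PiE) (auto simp: injections_def)
  also have "\<dots> = (\<Sum>f\<in>V \<rightarrow>\<^sub>E {..<n}. \<Prod>x\<in>V. if f x \<in> U then real n else 1)"
    using V by (simp add: prod.If_cases Int_def)
  also have "\<dots> = (\<Prod>x\<in>V. \<Sum>y<n. if y \<in> U then real n else 1)"
    using V by (intro prod_sum_PiE[symmetric]) auto
  also have "\<dots> = (real (card U) * real n + real (card ({..<n} - U))) ^ card V"
  proof -
    have "{..<n} \<inter> {y. y \<in> U} = U" "{..<n} \<inter> - {y. y \<in> U} = {..<n} - U" using U by auto
    then show ?thesis by (simp add: sum.If_cases)
  qed
  also have "\<dots> \<le> (real n * (real (card U) + 1)) ^ card V"
  proof (intro power_mono)
    have "card ({..<n} - U) \<le> n" using card_mono[of "{..<n}" "{..<n} - U"] by simp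
    then show "real (card U) * real n + real (card ({..<n} - U)) \<le> real n * (real (card U) + 1)"
      by (simp add: algebra_simps)
  qed simp
  finally show ?thesis .
qed

text \<open>The intersection of two labelled graphs, isolated common vertices included, pulled back to
\<open>H\<close>. Keeping all common vertices makes its vertex count equal to the number of hits that
\<open>sum_over_hits\<close> counts.\<close>

lemma overlap_subgraph:
  assumes J: "J \<in> copies n H" and H: "simple_graph H" and K: "simple_graph K"
    and f: "f \<in> injections (verts K) n"
  obtains S where "subgraph S H" "e S = card (edges J \<inter> edges (image_graph f K))"
    "v S = card {x \<in> verts K. f x \<in> verts J}"
proof -
  obtain g where g: "g \<in> injections (verts H) n" "J = image_graph g H"
    by (rule copy_is_image_graph[OF J H])
  have ig: "inj_on g (verts H)" and injf: "inj_on f (verts K)"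
    using g f by (auto simp: injections_def)
  define S where "S = ({x \<in> verts H. g x \<in> f ` verts K}, {d \<in> edges H. g ` d \<in> (`) f ` edges K})"
  have "d \<subseteq> verts S" if d: "d \<in> edges S" for d
  proof
    fix x assume x: "x \<in> d"
    have "x \<in> verts H" using that x simple_graphD(3)[OF H] by (auto simp: S_def)
    moreover have "g x \<in> f ` verts K"
    proof -
      obtain d' where d': "d' \<in> edges K" "g ` d = f ` d'" using d by (auto simp: S_def)
      then have "f ` d' \<subseteq> f ` verts K" using simple_graphD(3)[OF K] by (intro image_mono) auto
      then show ?thesis using d'(2) x by blast
    qed
    ultimately show "x \<in> verts S" by (simp add: S_def)
  qed
  then have "subgraph S H"
    using H by (auto simp: subgraph_def simple_graph_def S_def)
  moreover have "e S = card (edges J \<inter> edges (image_graph f K))"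
  proof -
    have "inj_on ((`) g) (edges S)"
      using simple_graphD(3)[OF H] by (intro inj_on_subset[OF inj_on_image_Pow[OF ig]]) (auto simp: S_def)
    moreover have "(`) g ` edges S = edges J \<inter> edges (image_graph f K)"
      by (auto simp: S_def g(2) image_graph_def)
    ultimately show ?thesis by (metis card_image e_def)
  qed
  moreover have "v S = card {x \<in> verts K. f x \<in> verts J}"
  proof -
    have preimage: "A \<inter> f ` B = f ` {x \<in> B. f x \<in> A}" for A B by auto
    have "g ` verts S = g ` verts H \<inter> f ` verts K" by (auto simp: S_def)
    also have "\<dots> = f ` {x \<in> verts K. f x \<in> verts J}"
      unfolding g(2) image_graph_def fst_conv by (rule preimage)
    finally have "g ` verts S = f ` {x \<in> verts K. f x \<in> verts J}" .
    moreover have "card (g ` verts S) = v S"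
      unfolding v_def by (intro card_image inj_on_subset[OF ig]) (auto simp: S_def)
    moreover have "card (f ` {x \<in> verts K. f x \<in> verts J}) = card {x \<in> verts K. f x \<in> verts J}"
      by (intro card_image inj_on_subset[OF injf]) auto
    ultimately show ?thesis by simp
  qed
  ultimately show ?thesis using that by blast
qed

section \<open>First moment bounds for the overlap of two replicas\<close>

lemma sum_gnp_superset:
  fixes p :: real
  assumes p: "p \<in> {0..1}" and T: "T \<subseteq> edges (complete_graph n)"
  shows "(\<Sum>y\<in>Pow (edges (complete_graph n)). of_bool (T \<subseteq> y) *
    (p ^ (card y - card T) * (1 - p) ^ (card (edges (complete_graph n)) - card y))) = 1"
proof -
  let ?E = "edges (complete_graph n)"
  have "(\<Sum>y\<in>Pow ?E. pmf (map_pmf (\<lambda>G. T \<union> G) (gnp n p)) y) = 1"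
    using T by (intro sum_pmf_eq_1) (auto simp: gnp_def edges_complete_graph_finite)
  moreover have "(\<Sum>y\<in>Pow ?E. pmf (map_pmf (\<lambda>G. T \<union> G) (gnp n p)) y) = (\<Sum>y\<in>Pow ?E. of_bool (T \<subseteq> y) *
    (p ^ (card y - card T) * (1 - p) ^ (card ?E - card y)))"
    by (intro sum.cong refl) (auto simp: pmf_gnp_union[OF p T])
  ultimately show ?thesis by simp
qed

lemma obs_weight_nonneg: "p \<in> {0..1} \<Longrightarrow> obs_weight n H p y \<ge> 0"
  by (simp add: obs_weight_def)

text \<open>Given a planted copy contained in \<open>T\<close>, the remaining edges of \<open>T\<close> have to come from the noise.\<close>

lemma sum_obs_weight_superset:
  assumes p: "p \<in> {0..1}" and T: "T \<subseteq> edges (complete_graph n)" and le: "e H \<le> card T"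
  shows "(\<Sum>y\<in>Pow (edges (complete_graph n)). of_bool (T \<subseteq> y) * obs_weight n H p y)
    = p ^ (card T - e H) / real (card (copies n H))"
proof -
  let ?E = "edges (complete_graph n)"
  have "(\<Sum>y\<in>Pow ?E. of_bool (T \<subseteq> y) * obs_weight n H p y) = (\<Sum>y\<in>Pow ?E.
     p ^ (card T - e H) / real (card (copies n H)) * (of_bool (T \<subseteq> y) *
    (p ^ (card y - card T) * (1 - p) ^ (card ?E - card y))))"
  proof (intro sum.cong refl)
    fix y assume y: "y \<in> Pow ?E"
    show "of_bool (T \<subseteq> y) * obs_weight n H p y =
     p ^ (card T - e H) / real (card (copies n H)) * (of_bool (T \<subseteq> y) *
    (p ^ (card y - card T) * (1 - p) ^ (card ?E - card y)))"
    proof (cases "T \<subseteq> y")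
      case True
      then have "card T \<le> card y"
        using y by (intro card_mono) (auto intro: finite_subset[OF _ edges_complete_graph_finite])
      then have "card y - e H = (card T - e H) + (card y - card T)" using le by simp
      then show ?thesis using True by (simp add: obs_weight_def power_add)
    qed simp
  qed
  then show ?thesis using sum_gnp_superset[OF p T] by (simp only: sum_distrib_left[symmetric] mult_1_right)
qed

lemma replica_weight_nonneg: "p \<in> {0..1} \<Longrightarrow> replica_weight n H p J J' \<ge> 0"
  unfolding replica_weight_def by (intro sum_nonneg) (simp add: obs_weight_nonneg)

lemma sum_replica_weight:
  "(\<Sum>J\<in>copies n H. \<Sum>J'\<in>copies n H. P J J' * replica_weight n H p J J')
   = (\<Sum>y\<in>Pow (edges (complete_graph n)). obs_weight n H p y / real (card (copies_in n H y)) *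
       (\<Sum>J\<in>copies_in n H y. \<Sum>J'\<in>copies_in n H y. P J J'))"
proof -
  let ?E = "edges (complete_graph n)" and ?C = "copies n H"
  let ?u = "\<lambda>y. obs_weight n H p y / real (card (copies_in n H y))"
  have "(\<Sum>J\<in>?C. \<Sum>J'\<in>?C. P J J' * replica_weight n H p J J')
    = (\<Sum>J\<in>?C. \<Sum>J'\<in>?C. \<Sum>y\<in>Pow ?E. ?u y * (of_bool (edges J \<subseteq> y) * (of_bool (edges J' \<subseteq> y) * P J J')))"
    unfolding replica_weight_def sum_distrib_left of_bool_conj by (simp add: mult_ac)
  also have "\<dots> = (\<Sum>J\<in>?C. \<Sum>y\<in>Pow ?E. \<Sum>J'\<in>?C. ?u y * (of_bool (edges J \<subseteq> y) * (of_bool (edges J' \<subseteq> y) * P J J')))"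
    by (intro sum.cong refl sum.swap)
  also have "\<dots> = (\<Sum>y\<in>Pow ?E. \<Sum>J\<in>?C. \<Sum>J'\<in>?C. ?u y * (of_bool (edges J \<subseteq> y) * (of_bool (edges J' \<subseteq> y) * P J J')))"
    by (rule sum.swap)
  finally show ?thesis by (simp only: sum_distrib_left[symmetric] sum_copies_of_bool)
qed

lemma sum_replica_weight_eq_1:
  assumes p: "p \<in> {0..1}" and ne: "copies n H \<noteq> {}"
  shows "(\<Sum>J\<in>copies n H. \<Sum>J'\<in>copies n H. replica_weight n H p J J') = 1"
proof -
  let ?E = "edges (complete_graph n)" and ?C = "copies n H"
  have "(\<Sum>J\<in>?C. \<Sum>J'\<in>?C. replica_weight n H p J J')
    = (\<Sum>y\<in>Pow ?E. obs_weight n H p y / real (card (copies_in n H y)) * (\<Sum>J\<in>copies_in n H y. \<Sum>J'\<in>copies_in n H y. 1))"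
    using sum_replica_weight[of "\<lambda>_ _. 1" n H p] by simp
  also have "\<dots> = (\<Sum>y\<in>Pow ?E. obs_weight n H p y * (\<Sum>J\<in>copies_in n H y. 1))"
    by (intro sum.cong refl) simp
  also have "\<dots> = (\<Sum>J\<in>?C. \<Sum>y\<in>Pow ?E. of_bool (edges J \<subseteq> y) * obs_weight n H p y)"
    unfolding sum_copies_of_bool[symmetric] sum_distrib_left
    by (subst sum.swap) (simp add: mult_ac)
  also have "\<dots> = (\<Sum>J\<in>?C. 1 / real (card ?C))"
  proof (intro sum.cong refl)
    fix J assume J: "J \<in> ?C"
    show "(\<Sum>y\<in>Pow ?E. of_bool (edges J \<subseteq> y) * obs_weight n H p y) = 1 / real (card ?C)"
      using sum_obs_weight_superset[OF p copies_edges(1)[OF J], of H] copies_edges(2)[OF J] by simp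
  qed
  also have "\<dots> = 1" using ne finite_copies[of n H] by (simp add: card_eq_0_iff)
  finally show ?thesis .
qed

definition overlap_prob :: "nat \<Rightarrow> 'a ugraph \<Rightarrow> real \<Rightarrow> (nat \<Rightarrow> bool) \<Rightarrow> real" where
  "overlap_prob n H p Q = (\<Sum>J\<in>copies n H. \<Sum>J'\<in>copies n H.
     of_bool (Q (card (edges J \<inter> edges J'))) * replica_weight n H p J J')"

lemma card_overlap_le:
  "J \<in> copies n H \<Longrightarrow> card (edges J \<inter> edges J') \<le> e H"
  using copies_edges(2,3) by (metis card_mono inf_le1)

lemma MMSE_upper:
  assumes p: "p \<in> {0..1}" and ne: "copies n H \<noteq> {}" and t: "0 \<le> t" "t \<le> real (e H)"
  shows "MMSE n H p \<le> real (e H) - t + real (e H) * overlap_prob n H p (\<lambda>k. real k < t)"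
proof -
  let ?C = "copies n H"
  let ?k = "\<lambda>J J'. card (edges J \<inter> edges J')"
  have "MMSE n H p \<le> (\<Sum>J\<in>?C. \<Sum>J'\<in>?C. (real (e H) - t) * replica_weight n H p J J'
      + real (e H) * (of_bool (real (?k J J') < t) * replica_weight n H p J J'))"
    unfolding MMSE_replica[OF p ne]
  proof (intro sum_mono)
    fix J J' assume J: "J \<in> ?C"
    have "real (e H) - real (?k J J') \<le> (real (e H) - t) + real (e H) * of_bool (real (?k J J') < t)"
      using card_overlap_le[OF J, of J'] t by auto
    from mult_right_mono[OF this replica_weight_nonneg[OF p, of n H J J']]
    show "replica_weight n H p J J' * (real (e H) - real (?k J J')) \<le> (real (e H) - t) * replica_weight n H p J J'
      + real (e H) * (of_bool (real (?k J J') < t) * replica_weight n H p J J')"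
      by (simp add: algebra_simps)
  qed
  also have "\<dots> = real (e H) - t + real (e H) * overlap_prob n H p (\<lambda>k. real k < t)"
    using sum_replica_weight_eq_1[OF p ne]
    by (simp only: sum.distrib sum_distrib_left[symmetric] overlap_prob_def) simp
  finally show ?thesis .
qed

lemma MMSE_lower:
  assumes p: "p \<in> {0..1}" and ne: "copies n H \<noteq> {}" and t: "t \<ge> 0"
  shows "real (e H) - t - real (e H) * overlap_prob n H p (\<lambda>k. t \<le> real k) \<le> MMSE n H p"
proof -
  let ?C = "copies n H"
  let ?k = "\<lambda>J J'. card (edges J \<inter> edges J')"
  have "real (e H) - t - real (e H) * overlap_prob n H p (\<lambda>k. t \<le> real k)
     = (\<Sum>J\<in>?C. \<Sum>J'\<in>?C. (real (e H) - t) * replica_weight n H p J J'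
      - real (e H) * (of_bool (t \<le> real (?k J J')) * replica_weight n H p J J'))"
    using sum_replica_weight_eq_1[OF p ne]
    by (simp only: sum_subtractf sum_distrib_left[symmetric] overlap_prob_def) simp
  also have "\<dots> \<le> MMSE n H p"
    unfolding MMSE_replica[OF p ne]
  proof (intro sum_mono)
    fix J J' assume J: "J \<in> ?C"
    have "(real (e H) - t) - real (e H) * of_bool (t \<le> real (?k J J')) \<le> real (e H) - real (?k J J')"
      using card_overlap_le[OF J, of J'] t by auto
    from mult_right_mono[OF this replica_weight_nonneg[OF p, of n H J J']]
    show "(real (e H) - t) * replica_weight n H p J J'
      - real (e H) * (of_bool (t \<le> real (?k J J')) * replica_weight n H p J J')
      \<le> replica_weight n H p J J' * (real (e H) - real (?k J J'))"
      by (simp add: algebra_simps)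
  qed
  finally show ?thesis .
qed

lemma MMSE_le:
  assumes p: "p \<in> {0..1}" and ne: "copies n H \<noteq> {}"
  shows "0 \<le> MMSE n H p" "MMSE n H p \<le> real (e H)"
proof -
  show "MMSE n H p \<le> real (e H)"
    using MMSE_upper[OF assms, of 0] by (simp add: overlap_prob_def)
  show "0 \<le> MMSE n H p"
    unfolding MMSE_replica[OF assms]
    by (intro sum_nonneg mult_nonneg_nonneg replica_weight_nonneg[OF p]) (simp add: card_overlap_le[where H = H])
qed

text \<open>The first moment method for a subgraph \<open>K\<close> of \<open>H\<close>: if a replica overlaps little with the planted
copy, then so does the copy of \<open>K\<close> inside it. A labelled copy of \<open>K\<close> that meets the planted copy in
\<open>S\<close> needs \<open>e K - e S\<close> further edges from the noise, and about \<open>n ^ (v K - v S)\<close> of the \<open>n ^ v K\<close>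
maps lead to the intersection \<open>S\<close>. Since the exponent of \<open>p\<close> is nonnegative, the bound is
monotone in \<open>p\<close>.\<close>

lemma small_overlap_unlikely:
  assumes p: "p \<in> {0..1}" and H: "simple_graph H" and fits: "v H \<le> n" and n: "n \<ge> 1"
    and K: "subgraph K H" and r: "r \<ge> 0"
    and key: "\<And>S. subgraph S H \<Longrightarrow> e S \<le> e K \<Longrightarrow> real (e S) < t \<Longrightarrow>
      p ^ (e K - e S) * real n ^ v K \<le> r * real n ^ v S"
  shows "overlap_prob n H p (\<lambda>k. real k < t) \<le> r * (real (v H) + 1) ^ v H"
proof -
  let ?E = "edges (complete_graph n)" and ?C = "copies n H" and ?w = "obs_weight n H p"
  let ?I = "injections (verts K) n"
  let ?ov = "\<lambda>J f. card (edges J \<inter> edges (image_graph f K))"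
  have ne: "?C \<noteq> {}" by (rule copies_nonempty[OF H fits])
  have sK: "simple_graph K" using K by (simp add: subgraph_def)
  have vK: "v K \<le> v H"
    using K simple_graphD(1)[OF H] by (auto simp: subgraph_def v_def intro: card_mono)
  have finI: "finite ?I" by (rule finite_injections[OF simple_graphD(1)[OF sK]])
  have "overlap_prob n H p (\<lambda>k. real k < t) = (\<Sum>y\<in>Pow ?E. \<Sum>J\<in>copies_in n H y.
      ?w y * ((\<Sum>J'\<in>copies_in n H y. of_bool (real (card (edges J \<inter> edges J')) < t)) / real (card (copies_in n H y))))"
    unfolding overlap_prob_def sum_replica_weight
    by (simp only: sum_distrib_left[symmetric] sum_divide_distrib[symmetric] times_divide_eq_left times_divide_eq_right)
  also have "\<dots> \<le> (\<Sum>y\<in>Pow ?E. \<Sum>J\<in>copies_in n H y.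
      ?w y * (\<Sum>f\<in>?I. of_bool (edges (image_graph f K) \<subseteq> y \<and> real (?ov J f) < t)))"
  proof (intro sum_mono mult_left_mono obs_weight_nonneg[OF p])
    fix y J
    let ?s = "(\<Sum>J'\<in>copies_in n H y. of_bool (real (card (edges J \<inter> edges J')) < t)) :: real"
    have s: "?s = real (card (copies_in n H y \<inter> {J'. real (card (edges J \<inter> edges J')) < t}))"
      by (simp add: finite_copies_in)
    show "?s / real (card (copies_in n H y))
      \<le> (\<Sum>f\<in>?I. of_bool (edges (image_graph f K) \<subseteq> y \<and> real (?ov J f) < t))"
    proof (cases "copies_in n H y \<inter> {J'. real (card (edges J \<inter> edges J')) < t} = {}")
      case True
      then show ?thesis unfolding s by (simp add: sum_nonneg del: sum_of_bool_eq)
    next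
      case False
      then obtain J' where J': "J' \<in> copies n H" "edges J' \<subseteq> y" "real (card (edges J \<inter> edges J')) < t"
        unfolding copies_in_def by blast
      obtain g where g: "g \<in> injections (verts H) n" "J' = image_graph g H"
        by (rule copy_is_image_graph[OF J'(1) H])
      \<comment> \<open>the copy of K inside the replica already witnesses the small overlap\<close>
      let ?f = "restrict g (verts K)"
      have KH: "verts K \<subseteq> verts H" "edges K \<subseteq> edges H" using K by (auto simp: subgraph_def)
      have f: "?f \<in> ?I"
        using g(1) KH(1) by (auto simp: injections_def inj_on_def)
      have "edges (image_graph ?f K) = (`) g ` edges K"
        unfolding image_graph_def snd_conv using simple_graphD(3)[OF sK]
        by (intro image_cong refl) auto
      then have sub: "edges (image_graph ?f K) \<subseteq> edges J'"
        using KH(2) g(2) by (auto simp: image_graph_def)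
      have "?ov J ?f \<le> card (edges J \<inter> edges J')"
        using sub copies_edges(3)[OF J'(1)] by (intro card_mono) auto
      then have "1 \<le> (of_bool (edges (image_graph ?f K) \<subseteq> y \<and> real (?ov J ?f) < t) :: real)"
        using sub J' by auto
      also have "\<dots> \<le> (\<Sum>f\<in>?I. of_bool (edges (image_graph f K) \<subseteq> y \<and> real (?ov J f) < t))"
        by (rule member_le_sum[OF f _ finI]) auto
      finally have "1 \<le> (\<Sum>f\<in>?I. of_bool (edges (image_graph f K) \<subseteq> y \<and> real (?ov J f) < t) :: real)" .
      moreover have "?s / real (card (copies_in n H y)) \<le> 1"
        unfolding s using card_mono[OF finite_copies_in[of n H y], of "copies_in n H y \<inter> {J'. real (card (edges J \<inter> edges J')) < t}"]
        by (auto simp: divide_le_eq_1)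
      ultimately show ?thesis by linarith
    qed
  qed
  also have "\<dots> = (\<Sum>y\<in>Pow ?E. \<Sum>J\<in>?C. \<Sum>f\<in>?I. of_bool (real (?ov J f) < t) *
      (of_bool (edges J \<union> edges (image_graph f K) \<subseteq> y) * ?w y))"
    unfolding sum_copies_of_bool[symmetric] sum_distrib_left Un_subset_iff of_bool_conj
    by (simp only: mult_ac)
  also have "\<dots> = (\<Sum>J\<in>?C. \<Sum>y\<in>Pow ?E. \<Sum>f\<in>?I. of_bool (real (?ov J f) < t) *
      (of_bool (edges J \<union> edges (image_graph f K) \<subseteq> y) * ?w y))"
    by (rule sum.swap)
  also have "\<dots> = (\<Sum>J\<in>?C. \<Sum>f\<in>?I. \<Sum>y\<in>Pow ?E. of_bool (real (?ov J f) < t) *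
      (of_bool (edges J \<union> edges (image_graph f K) \<subseteq> y) * ?w y))"
    by (intro sum.cong refl sum.swap)
  also have "\<dots> \<le> (\<Sum>J\<in>?C. r * (real (v H) + 1) ^ v H / real (card ?C))"
  proof (rule sum_mono)
    fix J assume J: "J \<in> ?C"
    have cJ: "card (verts J) = v H"
    proof -
      obtain g where g: "g \<in> injections (verts H) n" "J = image_graph g H"
        by (rule copy_is_image_graph[OF J H])
      then show ?thesis by (simp add: image_graph_def injections_def card_image v_def)
    qed
    have "(\<Sum>f\<in>?I. \<Sum>y\<in>Pow ?E. of_bool (real (?ov J f) < t) *
      (of_bool (edges J \<union> edges (image_graph f K) \<subseteq> y) * ?w y))
      \<le> (\<Sum>f\<in>?I. r / real (card ?C) / real n ^ v K * real n ^ card {x \<in> verts K. f x \<in> verts J})"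
    proof (rule sum_mono)
      fix f assume f: "f \<in> ?I"
      have fK: "image_graph f K \<in> copies n K" by (rule image_graph_in_copies[OF sK f])
      note fKD = copies_edges[OF fK]
      obtain S where S: "subgraph S H" "e S = ?ov J f" "v S = card {x \<in> verts K. f x \<in> verts J}"
        by (rule overlap_subgraph[OF J H sK f])
      show "(\<Sum>y\<in>Pow ?E. of_bool (real (?ov J f) < t) *
      (of_bool (edges J \<union> edges (image_graph f K) \<subseteq> y) * ?w y)) \<le>
        r / real (card ?C) / real n ^ v K * real n ^ card {x \<in> verts K. f x \<in> verts J}"
      proof (cases "real (?ov J f) < t")
        case True
        have le: "e S \<le> e K" unfolding S(2) using fKD(2,3) by (metis card_mono inf_le2)
        have cu: "card (edges J \<union> edges (image_graph f K)) - e H = e K - e S"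
          using card_Un_Int[OF copies_edges(3)[OF J] fKD(3)] le
          by (simp add: S(2) copies_edges(2)[OF J] fKD(2))
        have "(\<Sum>y\<in>Pow ?E. of_bool (real (?ov J f) < t) *
          (of_bool (edges J \<union> edges (image_graph f K) \<subseteq> y) * ?w y))
          = (\<Sum>y\<in>Pow ?E. of_bool (edges J \<union> edges (image_graph f K) \<subseteq> y) * ?w y)"
          using True by simp
        also have "\<dots> = p ^ (e K - e S) / real (card ?C)"
        proof -
          have "e H \<le> card (edges J \<union> edges (image_graph f K))"
            unfolding copies_edges(2)[OF J, symmetric]
            using copies_edges(3)[OF J] fKD(3) by (intro card_mono) auto
          moreover have "edges J \<union> edges (image_graph f K) \<subseteq> ?E"
            using copies_edges(1)[OF J] fKD(1) by auto
          ultimately show ?thesis using sum_obs_weight_superset[OF p] cu by metis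
        qed
        also have "\<dots> \<le> (r * real n ^ v S / real n ^ v K) / real (card ?C)"
          using key[OF S(1) le] True S(2) n by (intro divide_right_mono) (simp_all add: field_simps)
        finally show ?thesis by (simp add: S(3) mult_ac)
      next
        case False
        then show ?thesis using r by simp
      qed
    qed
    also have "\<dots> \<le> r / real (card ?C) / real n ^ v K * (real n * (real (v H) + 1)) ^ v K"
    proof -
      have "verts J \<subseteq> {..<n}" using J by (auto simp: copies_def subgraph_def complete_graph_def)
      from sum_over_hits[OF simple_graphD(1)[OF sK] this] show ?thesis
        unfolding sum_distrib_left[symmetric] cJ v_def[of K, symmetric]
        using r by (intro mult_left_mono) auto
    qed
    also have "\<dots> = r * (real (v H) + 1) ^ v K / real (card ?C)"
      using n by (simp add: power_mult_distrib)
    also have "\<dots> \<le> r * (real (v H) + 1) ^ v H / real (card ?C)"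
      using r vK by (intro divide_right_mono mult_left_mono power_increasing) auto
    finally show "(\<Sum>f\<in>?I. \<Sum>y\<in>Pow ?E. of_bool (real (?ov J f) < t) *
      (of_bool (edges J \<union> edges (image_graph f K) \<subseteq> y) * ?w y)) \<le> r * (real (v H) + 1) ^ v H / real (card ?C)" .
  qed
  also have "\<dots> = r * (real (v H) + 1) ^ v H"
    using ne finite_copies[of n H] by (simp add: card_eq_0_iff)
  finally show ?thesis .
qed

text \<open>The number of copies in the observation is the likelihood ratio of the planted model to the
null model \<open>gnp\<close>, up to the factor \<open>Z0\<close>, its null mean. Hence it is at least \<open>\<delta> * Z0\<close>, except on an
event of planted probability at most \<open>\<delta>\<close>. Dividing by \<open>\<delta> * Z0\<close> instead of the true number reduces the
probability of a large overlap to a first moment.\<close>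

lemma large_overlap_unlikely:
  assumes p: "p \<in> {0<..1}" and H: "simple_graph H" and fits: "v H \<le> n" and n: "n \<ge> 1"
    and r: "r \<ge> 0" and \<delta>: "\<delta> > 0"
    and key: "\<And>S. subgraph S H \<Longrightarrow> t \<le> real (e S) \<Longrightarrow> 1 \<le> r * p ^ e S * real n ^ v S"
  shows "overlap_prob n H p (\<lambda>k. t \<le> real k) \<le>
    \<delta> + r * (real (v H) + 1) ^ v H * real (v H) ^ (2 * v H) / \<delta>"
proof -
  let ?E = "edges (complete_graph n)" and ?C = "copies n H" and ?w = "obs_weight n H p"
  let ?I = "injections (verts H) n"
  let ?k = "\<lambda>J J'. card (edges J \<inter> edges J')"
  let ?Z = "\<lambda>y. real (card (copies_in n H y))"
  let ?c = "real (card ?C)"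
  have p': "p \<in> {0..1}" using p by auto
  have ne: "?C \<noteq> {}" by (rule copies_nonempty[OF H fits])
  have c: "?c > 0" using ne finite_copies[of n H] by (simp add: card_gt_0_iff)
  define Z0 where "Z0 = ?c * p ^ e H"
  have Z0: "Z0 > 0" using c p by (simp add: Z0_def)
  have "overlap_prob n H p (\<lambda>k. t \<le> real k) = (\<Sum>y\<in>Pow ?E. ?w y *
     ((\<Sum>J\<in>copies_in n H y. \<Sum>J'\<in>copies_in n H y. of_bool (t \<le> real (?k J J'))) / ?Z y))"
    unfolding overlap_prob_def sum_replica_weight by simp
  also have "\<dots> \<le> (\<Sum>y\<in>Pow ?E. ?w y * (of_bool (?Z y > 0) * (\<delta> * Z0) +
     (\<Sum>J\<in>copies_in n H y. \<Sum>J'\<in>copies_in n H y. of_bool (t \<le> real (?k J J'))) / (\<delta> * Z0)))"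
  proof (intro sum_mono mult_left_mono obs_weight_nonneg[OF p'])
    fix y
    let ?X = "(\<Sum>J\<in>copies_in n H y. \<Sum>J'\<in>copies_in n H y. of_bool (t \<le> real (?k J J'))) :: real"
    have X0: "?X \<ge> 0" by (intro sum_nonneg) auto
    have "?X \<le> (\<Sum>J\<in>copies_in n H y. \<Sum>J'\<in>copies_in n H y. 1)" by (intro sum_mono) auto
    then have X1: "?X \<le> ?Z y * ?Z y" by simp
    \<comment> \<open>if there are at most \<delta> * Z0 copies, bound the overlap fraction by 1; otherwise decrease its denominator to \<delta> * Z0\<close>
    consider "?Z y = 0" | "?Z y > 0" "?Z y \<le> \<delta> * Z0" | "?Z y > \<delta> * Z0" by fastforce
    then show "?X / ?Z y \<le> of_bool (?Z y > 0) * (\<delta> * Z0) + ?X / (\<delta> * Z0)"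
    proof cases
      case 1
      then show ?thesis using X0 Z0 \<delta> by simp
    next
      case 2
      have "?X / ?Z y \<le> ?Z y" using X1 2(1) by (simp add: divide_le_eq)
      moreover have "0 \<le> ?X / (\<delta> * Z0)" using X0 Z0 \<delta> by simp
      ultimately show ?thesis using 2 by simp
    next
      case 3
      have "?X / ?Z y \<le> ?X / (\<delta> * Z0)" using X0 3 Z0 \<delta> less_trans[OF mult_pos_pos[OF \<delta> Z0] 3]
        by (intro divide_left_mono mult_pos_pos) auto
      moreover have "0 \<le> of_bool (?Z y > 0) * (\<delta> * Z0)" using Z0 \<delta> by simp
      ultimately show ?thesis by linarith
    qed
  qed
  also have "\<dots> = \<delta> * (\<Sum>y\<in>Pow ?E. of_bool (?Z y > 0) * (?w y * Z0)) +
     (\<Sum>y\<in>Pow ?E. ?w y * (\<Sum>J\<in>copies_in n H y. \<Sum>J'\<in>copies_in n H y. of_bool (t \<le> real (?k J J')))) / (\<delta> * Z0)"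
    by (simp add: distrib_left sum.distrib sum_distrib_left sum_divide_distrib mult_ac)
  also have "\<dots> \<le> \<delta> * 1 + (?c * (?c * (p ^ e H * (r * (real (v H) + 1) ^ v H * real (v H) ^ (2 * v H))) / ?c)) / (\<delta> * Z0)"
  proof (intro add_mono mult_left_mono divide_right_mono)
    have "(\<Sum>y\<in>Pow ?E. of_bool (?Z y > 0) * (?w y * Z0)) \<le>
      (\<Sum>y\<in>Pow ?E. of_bool ({} \<subseteq> y) * (p ^ (card y - card ({} :: nat set set)) * (1 - p) ^ (card ?E - card y)))"
    proof (rule sum_mono)
      fix y assume y: "y \<in> Pow ?E"
      show "of_bool (?Z y > 0) * (?w y * Z0) \<le> of_bool ({} \<subseteq> y) * (p ^ (card y - card ({} :: nat set set)) * (1 - p) ^ (card ?E - card y))"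
      proof (cases "?Z y > 0")
        case True
        then obtain J where J: "J \<in> ?C" "edges J \<subseteq> y" by (auto simp: card_gt_0_iff copies_in_def)
        have "e H \<le> card y"
          unfolding copies_edges(2)[OF J(1), symmetric]
          using J(2) y by (intro card_mono) (auto intro: finite_subset[OF _ edges_complete_graph_finite])
        then have "p ^ card y = p ^ (card y - e H) * p ^ e H" by (simp add: power_add[symmetric])
        then show ?thesis using True c by (simp add: obs_weight_def Z0_def)
      qed (use p in simp)
    qed
    also have "\<dots> = 1" by (rule sum_gnp_superset[OF p']) simp
    finally show "(\<Sum>y\<in>Pow ?E. of_bool (?Z y > 0) * (?w y * Z0)) \<le> 1" .
  next
    have "(\<Sum>y\<in>Pow ?E. ?w y * (\<Sum>J\<in>copies_in n H y. \<Sum>J'\<in>copies_in n H y. of_bool (t \<le> real (?k J J'))))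
      = (\<Sum>y\<in>Pow ?E. \<Sum>J\<in>?C. \<Sum>J'\<in>?C. of_bool (t \<le> real (?k J J')) * (of_bool (edges J \<union> edges J' \<subseteq> y) * ?w y))"
      unfolding sum_copies_of_bool[symmetric] sum_distrib_left Un_subset_iff of_bool_conj
      by (simp add: mult_ac)
    also have "\<dots> = (\<Sum>J\<in>?C. \<Sum>y\<in>Pow ?E. \<Sum>J'\<in>?C. of_bool (t \<le> real (?k J J')) * (of_bool (edges J \<union> edges J' \<subseteq> y) * ?w y))"
      by (rule sum.swap)
    also have "\<dots> = (\<Sum>J\<in>?C. \<Sum>J'\<in>?C. \<Sum>y\<in>Pow ?E. of_bool (t \<le> real (?k J J')) * (of_bool (edges J \<union> edges J' \<subseteq> y) * ?w y))"
      by (intro sum.cong refl sum.swap)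
    also have "\<dots> \<le> (\<Sum>J\<in>?C. ?c * (p ^ e H * (r * (real (v H) + 1) ^ v H * real (v H) ^ (2 * v H))) / ?c)"
    proof (rule sum_mono)
      fix J assume J: "J \<in> ?C"
      have cJ: "card (verts J) = v H"
      proof -
        obtain g where g: "g \<in> injections (verts H) n" "J = image_graph g H"
          by (rule copy_is_image_graph[OF J H])
        then show ?thesis by (simp add: image_graph_def injections_def card_image v_def)
      qed
      have "(\<Sum>J'\<in>?C. \<Sum>y\<in>Pow ?E. of_bool (t \<le> real (?k J J')) * (of_bool (edges J \<union> edges J' \<subseteq> y) * ?w y))
        = (\<Sum>J'\<in>?C. of_bool (t \<le> real (?k J J')) * (p ^ (e H - ?k J J') / ?c))"
      proof (intro sum.cong refl)
        fix J' assume J': "J' \<in> ?C"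
        have "e H \<le> card (edges J \<union> edges J')"
          unfolding copies_edges(2)[OF J, symmetric]
          using copies_edges(3)[OF J] copies_edges(3)[OF J'] by (intro card_mono) auto
        moreover have "edges J \<union> edges J' \<subseteq> ?E"
          using copies_edges(1)[OF J] copies_edges(1)[OF J'] by auto
        moreover have "card (edges J \<union> edges J') - e H = e H - ?k J J'"
          using card_Un_Int[OF copies_edges(3)[OF J] copies_edges(3)[OF J']]
          by (simp add: copies_edges(2)[OF J] copies_edges(2)[OF J'])
        ultimately have "(\<Sum>y\<in>Pow ?E. of_bool (edges J \<union> edges J' \<subseteq> y) * ?w y) = p ^ (e H - ?k J J') / ?c"
          using sum_obs_weight_superset[OF p'] by metis
        then show "(\<Sum>y\<in>Pow ?E. of_bool (t \<le> real (?k J J')) * (of_bool (edges J \<union> edges J' \<subseteq> y) * ?w y))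
          = of_bool (t \<le> real (?k J J')) * (p ^ (e H - ?k J J') / ?c)"
          by (simp only: sum_distrib_left[symmetric])
      qed
      also have "\<dots> \<le> (\<Sum>f\<in>?I. of_bool (t \<le> real (?k J (image_graph f H))) * (p ^ (e H - ?k J (image_graph f H)) / ?c))"
        unfolding copies_eq_image[OF H] using p
        by (intro sum_image_le[unfolded comp_def] finite_injections simple_graphD(1)[OF H]) auto
      also have "\<dots> \<le> (\<Sum>f\<in>?I. p ^ e H * r / ?c * real n ^ card {x \<in> verts H. f x \<in> verts J})"
      proof (rule sum_mono)
        fix f assume f: "f \<in> ?I"
        obtain S where S: "subgraph S H" "e S = ?k J (image_graph f H)" "v S = card {x \<in> verts H. f x \<in> verts J}"
          by (rule overlap_subgraph[OF J H H f])
        have "p ^ (e H - e S) \<le> p ^ e H * r * real n ^ v S" if "t \<le> real (e S)"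
        proof -
          have "e S \<le> e H" unfolding S(2) by (rule card_overlap_le[OF J])
          then have "p ^ e H = p ^ (e H - e S) * p ^ e S" by (simp add: power_add[symmetric])
          moreover have "p ^ (e H - e S) * 1 \<le> p ^ (e H - e S) * (r * p ^ e S * real n ^ v S)"
            using key[OF S(1) that] p by (intro mult_left_mono) auto
          ultimately show ?thesis by (simp add: mult_ac)
        qed
        then show "of_bool (t \<le> real (?k J (image_graph f H))) * (p ^ (e H - ?k J (image_graph f H)) / ?c)
          \<le> p ^ e H * r / ?c * real n ^ card {x \<in> verts H. f x \<in> verts J}"
          unfolding S(2,3)[symmetric] using c r p by (auto simp: field_simps)
      qed
      also have "\<dots> \<le> p ^ e H * r / ?c * (real n * (real (v H) + 1)) ^ v H"
      proof -
        have "verts J \<subseteq> {..<n}" using J by (auto simp: copies_def subgraph_def complete_graph_def)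
        from sum_over_hits[OF simple_graphD(1)[OF H] this] show ?thesis
          unfolding sum_distrib_left[symmetric] cJ v_def[of H, symmetric]
          using r p by (intro mult_left_mono) auto
      qed
      also have "\<dots> = p ^ e H * r / ?c * (real (v H) + 1) ^ v H * real n ^ v H"
        by (simp add: power_mult_distrib)
      also have "\<dots> \<le> p ^ e H * r / ?c * (real (v H) + 1) ^ v H * (?c * real (v H) ^ (2 * v H))"
        using card_copies_lower[OF H fits] r p by (intro mult_left_mono) auto
      finally show "(\<Sum>J'\<in>?C. \<Sum>y\<in>Pow ?E. of_bool (t \<le> real (?k J J')) * (of_bool (edges J \<union> edges J' \<subseteq> y) * ?w y))
        \<le> ?c * (p ^ e H * (r * (real (v H) + 1) ^ v H * real (v H) ^ (2 * v H))) / ?c"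
        by (simp add: mult_ac)
    qed
    finally show "(\<Sum>y\<in>Pow ?E. ?w y * (\<Sum>J\<in>copies_in n H y. \<Sum>J'\<in>copies_in n H y. of_bool (t \<le> real (?k J J'))))
      \<le> ?c * (?c * (p ^ e H * (r * (real (v H) + 1) ^ v H * real (v H) ^ (2 * v H))) / ?c)"
      by simp
  qed (use \<delta> Z0 in auto)
  also have "\<dots> = \<delta> + r * (real (v H) + 1) ^ v H * real (v H) ^ (2 * v H) / \<delta>"
    using c p by (simp add: Z0_def field_simps)
  finally show ?thesis .
qed

section \<open>First moment thresholds\<close>

lemma card_Aut_bounds:
  assumes "simple_graph J"
  shows "1 \<le> card (Aut J)" "card (Aut J) \<le> fact (v J)"
proof -
  have fin: "finite {f. f permutes verts J}"
    using simple_graphD(1)[OF assms] by (rule finite_permutations)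
  have sub: "Aut J \<subseteq> {f. f permutes verts J}" by (auto simp: Aut_def)
  show "card (Aut J) \<le> fact (v J)"
    using card_mono[OF fin sub] card_permutations[OF refl simple_graphD(1)[OF assms]] by (simp add: v_def)
  have "id \<in> Aut J" by (simp add: Aut_def permutes_id)
  then show "1 \<le> card (Aut J)"
    using finite_subset[OF sub fin] by (auto simp: Suc_le_eq card_gt_0_iff)
qed

text \<open>Up to powers of \<open>v J ^ v J\<close> the number of copies is \<open>n ^ v J\<close>; the comparison holds for all \<open>v J \<le> n\<close>
since each factor of the falling factorial is at least \<open>n / v J\<close>.\<close>

lemma num_copies_bounds:
  assumes J: "simple_graph J" and le: "v J \<le> n"
  shows "1 \<le> num_copies n J" "num_copies n J \<le> real n ^ v J"
    "real n ^ v J \<le> num_copies n J * real (v J) ^ (2 * v J)"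
proof -
  define F where "F = (\<Prod>i<v J. n - i)"
  have fact_n: "fact n = fact (n - v J) * F"
    unfolding F_def by (rule fact_falling_factorial[OF le])
  then have "(fact n :: real) = fact (n - v J) * real F" by (metis of_nat_fact of_nat_mult)
  then have num: "num_copies n J = real F / real (card (Aut J))" by (simp add: num_copies_def)
  note aut = card_Aut_bounds[OF J]
  have "fact (n - v J) * (fact (v J) * (n choose v J)) = fact (n - v J) * F"
    using binomial_fact_lemma[OF le] fact_n by (simp add: mult_ac)
  then have "F = fact (v J) * (n choose v J)" by simp
  moreover have "1 \<le> n choose v J" using le by (simp add: Suc_le_eq)
  ultimately have "card (Aut J) \<le> F" using aut(2) by (metis le_trans mult_le_mono2 nat_mult_1_right)
  then show "1 \<le> num_copies n J" using aut(1) by (simp add: num)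
  have "F \<le> (\<Prod>i<v J. n)" unfolding F_def by (intro prod_mono) auto
  then have "real F \<le> real n ^ v J" by (metis card_lessThan of_nat_le_iff of_nat_power prod_constant)
  moreover have "real F / real (card (Aut J)) \<le> real F / 1" using aut(1) by (intro divide_left_mono) auto
  ultimately show "num_copies n J \<le> real n ^ v J" unfolding num by linarith
  have "fact (v J) \<le> v J ^ v J" using fact_le_power[of "v J", where 'a = nat] by simp
  then have a: "card (Aut J) \<le> v J ^ v J" using aut(2) by simp
  have "n ^ v J \<le> F * v J ^ v J" unfolding F_def by (rule falling_factorial_lower[OF le])
  then have "real (n ^ v J) \<le> real (F * v J ^ v J)" by (simp only: of_nat_le_iff)
  also have "\<dots> = num_copies n J * (real (card (Aut J)) * real (v J) ^ v J)"
    using aut(1) by (simp add: num)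
  also have "\<dots> \<le> num_copies n J * (real (v J ^ v J) * real (v J) ^ v J)"
    using a \<open>1 \<le> num_copies n J\<close> by (intro mult_left_mono mult_right_mono) (simp_all only: of_nat_le_iff, auto)
  finally show "real n ^ v J \<le> num_copies n J * real (v J) ^ (2 * v J)"
    by (simp add: mult_2 power_add)
qed

lemma p_1M_facts:
  assumes J: "simple_graph J" and le: "v J \<le> n" and e: "1 \<le> e J"
  shows "0 < p_1M n J" "p_1M n J \<le> 1" "p_1M n J ^ e J = 1 / num_copies n J"
proof -
  note M = num_copies_bounds(1)[OF J le]
  show "0 < p_1M n J" using M by (simp add: p_1M_def)
  show "p_1M n J \<le> 1" unfolding p_1M_def using M powr_mono[of "- 1 / real (e J)" 0 "num_copies n J"] by simp
  have "p_1M n J ^ e J = num_copies n J powr (- 1 / real (e J) * real (e J))"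
    using M by (simp add: p_1M_def powr_powr flip: powr_realpow)
  also have "\<dots> = 1 / num_copies n J" using e M by (simp add: powr_minus_divide)
  finally show "p_1M n J ^ e J = 1 / num_copies n J" .
qed

lemma finite_large_subgraphs:
  assumes "simple_graph H"
  shows "finite (large_subgraphs q H)"
proof (rule finite_subset)
  show "large_subgraphs q H \<subseteq> Pow (verts H) \<times> Pow (edges H)"
    by (auto simp: large_subgraphs_def subgraph_def)
qed (use simple_graphD[OF assms] in simp)

lemma self_in_large_subgraphs:
  assumes "simple_graph H" "1 \<le> e H" "q \<le> 1"
  shows "H \<in> large_subgraphs q H"
  using assms mult_right_mono[of q 1 "real (e H)"] by (auto simp: large_subgraphs_def subgraph_def)

lemma large_subgraphsD:
  assumes "J \<in> large_subgraphs q H"  and "simple_graph H"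
  shows "simple_graph J" "v J \<le> v H" "1 \<le> e J" "q * real (e H) \<le> real (e J)" "subgraph J H"
  using assms simple_graphD(1)[OF assms(2)]
  by (auto simp: large_subgraphs_def subgraph_def v_def intro!: card_mono)

lemma \<psi>_ge:
  assumes "simple_graph H" "J \<in> large_subgraphs q H"
  shows "p_1M n J \<le> \<psi> n q H"
  unfolding \<psi>_def using assms finite_large_subgraphs[OF assms(1)] by (intro Max_ge) auto

lemma \<psi>_attained:
  assumes "simple_graph H" "1 \<le> e H" "q \<le> 1"
  obtains K where "K \<in> large_subgraphs q H" "p_1M n K = \<psi> n q H"
proof -
  have "\<psi> n q H \<in> p_1M n ` large_subgraphs q H"
    unfolding \<psi>_def using assms finite_large_subgraphs self_in_large_subgraphs by (intro Max_in) blast+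
  then show ?thesis using that by auto
qed

lemma \<psi>_bounds:
  assumes "simple_graph H" "v H \<le> n" "1 \<le> e H" "q \<le> 1"
  shows "0 < \<psi> n q H" "\<psi> n q H \<le> 1"
proof -
  obtain K where K: "K \<in> large_subgraphs q H" "p_1M n K = \<psi> n q H"
    by (rule \<psi>_attained[OF assms(1,3,4)])
  note D = large_subgraphsD[OF K(1) assms(1)]
  show "0 < \<psi> n q H" "\<psi> n q H \<le> 1"
    using p_1M_facts(1,2)[OF D(1) _ D(3), of n] D(2) assms(2) K(2) by auto
qed

lemma \<psi>_antimono:
  assumes "simple_graph H" "1 \<le> e H" "q \<le> q'" "q' \<le> 1"
  shows "\<psi> n q' H \<le> \<psi> n q H"
proof -
  obtain K where K: "K \<in> large_subgraphs q' H" "p_1M n K = \<psi> n q' H"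
    by (rule \<psi>_attained[OF assms(1,2,4)])
  have "q * real (e H) \<le> q' * real (e H)" using assms(3) by (intro mult_right_mono) auto
  then have "K \<in> large_subgraphs q H" using K(1) by (auto simp: large_subgraphs_def)
  then show ?thesis using \<psi>_ge[OF assms(1)] K(2) by metis
qed

lemma \<psi>_power_ge:
  assumes H: "simple_graph H" "v H \<le> n" and S: "S \<in> large_subgraphs q H"
  shows "1 \<le> \<psi> n q H ^ e S * real n ^ v S"
proof -
  note D = large_subgraphsD[OF S H(1)]
  have vS: "v S \<le> n" using D(2) H(2) by simp
  note M = num_copies_bounds[OF D(1) vS] and P = p_1M_facts[OF D(1) vS D(3)]
  have "1 = p_1M n S ^ e S * num_copies n S" using M(1) P(3) by simp
  also have "\<dots> \<le> \<psi> n q H ^ e S * real n ^ v S"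
    using M P(1) \<psi>_ge[OF H(1) S, of n] by (intro mult_mono power_mono) auto
  finally show ?thesis .
qed

text \<open>The expected number of copies of the maximizer is 1 at \<open>p = \<psi>\<close>, so the lower bound
\<open>\<psi>_power_ge\<close> is sharp for it up to the loss in passing from copies to labelled copies.\<close>

lemma \<psi>_maximizer:
  assumes H: "simple_graph H" "v H \<le> n" and q: "1 \<le> e H" "q \<le> 1"
  obtains K where "K \<in> large_subgraphs q H" "\<psi> n q H ^ e K * real n ^ v K \<le> real (v H) ^ (2 * v H)"
proof -
  obtain K where K: "K \<in> large_subgraphs q H" "p_1M n K = \<psi> n q H"
    by (rule \<psi>_attained[OF H(1) q])
  note D = large_subgraphsD[OF K(1) H(1)]
  have vK: "v K \<le> n" using D(2) H(2) by simp
  note M = num_copies_bounds[OF D(1) vK] and P = p_1M_facts[OF D(1) vK D(3)]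
  have "edges K \<noteq> {}" using D(3) by (auto simp: e_def)
  then have "verts K \<noteq> {}" using D(1) by (auto simp: simple_graph_def)
  then have v0: "1 \<le> v K" using simple_graphD(1)[OF D(1)] by (simp add: v_def Suc_le_eq card_gt_0_iff)
  have "\<psi> n q H ^ e K * real n ^ v K \<le> 1 / num_copies n K * (num_copies n K * real (v K) ^ (2 * v K))"
    using M P(3) K(2) by (intro mult_mono) auto
  also have "\<dots> = real (v K) ^ (2 * v K)" using M(1) by simp
  also have "\<dots> \<le> real (v H) ^ (2 * v K)" using D(2) by (intro power_mono) auto
  also have "\<dots> \<le> real (v H) ^ (2 * v H)" using D(2) v0 by (intro power_increasing) auto
  finally show ?thesis using that K(1) by blast
qed

text \<open>An extension of \<open>\<psi>_power_ge\<close> to subgraphs with arbitrarily few edges. The minimizer of \<open>v / e\<close> over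
the subgraphs with a fraction \<open>q0\<close> of the edges gives \<open>\<psi> \<ge> n powr (- \<alpha> q0 H)\<close>. Delocalization says that
the exponent exceeds no ratio \<open>v S / e S\<close> by more than \<open>C / ln n\<close>, and \<open>n powr (C / ln n)\<close> is the
constant \<open>exp C\<close>.\<close>

lemma \<psi>_power_ge_delocalized:
  assumes H: "simple_graph H" "v H \<le> n" and q: "q \<le> q0" "q0 \<le> 1" and n: "n \<ge> 2"
    and deloc: "\<alpha> q0 H \<le> \<alpha> 0 H + C / ln (real n)"
    and S: "subgraph S H" "1 \<le> e S"
  shows "1 \<le> exp (C * real (e S)) * \<psi> n q H ^ e S * real n ^ v S"
proof -
  have eS: "e S \<le> e H"
    using S(1) simple_graphD(2)[OF H(1)] by (auto simp: e_def subgraph_def intro: card_mono)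
  then have eH: "1 \<le> e H" using S(2) by simp
  let ?r = "\<lambda>J. real (v J) / real (e J)"
  have "\<alpha> q0 H \<in> ?r ` large_subgraphs q0 H"
    unfolding \<alpha>_def using finite_large_subgraphs[OF H(1)] self_in_large_subgraphs[OF H(1) eH q(2)]
    by (subst cInf_eq_Min) (auto intro!: Min_in)
  then obtain K where K: "K \<in> large_subgraphs q0 H" "\<alpha> q0 H = ?r K" by auto
  note D = large_subgraphsD[OF K(1) H(1)]
  have vK: "v K \<le> n" using D(2) H(2) by simp
  note M = num_copies_bounds[OF D(1) vK]
  have "S \<in> large_subgraphs 0 H" using S by (simp add: large_subgraphs_def)
  then have "\<alpha> 0 H \<le> ?r S"
    unfolding \<alpha>_def using finite_large_subgraphs[OF H(1)] by (intro cINF_lower) auto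
  then have "\<alpha> q0 H \<le> ?r S + C / ln (real n)" using deloc by simp
  then have "\<alpha> q0 H * real (e S) \<le> (?r S + C / ln (real n)) * real (e S)"
    by (rule mult_right_mono) simp
  then have "\<alpha> q0 H * real (e S) \<le> real (v S) + C * real (e S) / ln (real n)"
    using S(2) by (simp add: distrib_right)
  then have exponent: "0 \<le> C * real (e S) / ln (real n) + - \<alpha> q0 H * real (e S) + real (v S)" by simp
  have "real n powr (- \<alpha> q0 H) = (real n ^ v K) powr (- 1 / real (e K))"
    using n K(2) by (simp add: powr_powr flip: powr_realpow)
  also have "\<dots> \<le> p_1M n K"
    unfolding p_1M_def using M n by (intro powr_mono2') auto
  also have "\<dots> \<le> \<psi> n q0 H" by (rule \<psi>_ge[OF H(1) K(1)])
  also have "\<dots> \<le> \<psi> n q H" by (rule \<psi>_antimono[OF H(1) eH q])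
  finally have \<psi>: "real n powr (- \<alpha> q0 H) \<le> \<psi> n q H" .
  have "1 \<le> real n powr (C * real (e S) / ln (real n) + - \<alpha> q0 H * real (e S) + real (v S))"
    using exponent n powr_mono[of 0 _ "real n"] by simp
  also have "\<dots> = exp (C * real (e S)) * (real n powr (- \<alpha> q0 H)) ^ e S * real n ^ v S"
  proof -
    have "real n powr (C * real (e S) / ln (real n)) = exp (C * real (e S))"
      using n by (simp add: powr_def)
    moreover have "real n powr (- \<alpha> q0 H * real (e S)) = (real n powr (- \<alpha> q0 H)) ^ e S"
      using n by (simp add: powr_powr flip: powr_realpow)
    ultimately show ?thesis unfolding powr_add using n by (simp add: powr_realpow)
  qed
  also have "\<dots> \<le> exp (C * real (e S)) * \<psi> n q H ^ e S * real n ^ v S"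
    using \<psi> by (intro mult_right_mono mult_left_mono power_mono) auto
  finally show ?thesis .
qed

text \<open>The total loss from working with labelled copies and from the choice of the vertices in which
two copies overlap. It is subexponential in the number of edges of a dense graph.\<close>

definition growth :: "'a ugraph \<Rightarrow> real" where
  "growth H = (real (v H) + 1) ^ v H * real (v H) ^ (2 * v H)"

lemma overlap_above_threshold:
  assumes H: "simple_graph H" "v H \<le> n" "1 \<le> e H" and n: "n \<ge> 1"
    and q: "0 < q" "q \<le> 1" and p: "p \<in> {0..1}" "(1 + \<epsilon>) * \<psi> n q H \<le> p"
    and \<epsilon>: "\<epsilon> > 0" and \<delta>: "\<delta> > 0"
  shows "overlap_prob n H p (\<lambda>k. q * real (e H) \<le> real k)
    \<le> \<delta> + (1 + \<epsilon>) powr (- (q * real (e H))) * growth H / \<delta>"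
proof -
  note \<psi> = \<psi>_bounds[OF H q(2)]
  have p0: "p > 0" using p(2) \<psi>(1) \<epsilon> by (smt (verit) mult_pos_pos)
  have "overlap_prob n H p (\<lambda>k. q * real (e H) \<le> real k) \<le> \<delta> +
    (1 + \<epsilon>) powr (- (q * real (e H))) * (real (v H) + 1) ^ v H * real (v H) ^ (2 * v H) / \<delta>"
  proof (rule large_overlap_unlikely[OF _ H(1,2) n _ \<delta>])
    fix S assume S: "subgraph S H" "q * real (e H) \<le> real (e S)"
    have "0 < q * real (e H)" using q H(3) by simp
    then have "1 \<le> e S" using S(2) by (smt (verit) of_nat_0 of_nat_less_iff Suc_leI One_nat_def)
    then have "S \<in> large_subgraphs q H" using S by (simp add: large_subgraphs_def)
    then have "1 \<le> \<psi> n q H ^ e S * real n ^ v S" by (rule \<psi>_power_ge[OF H(1,2)])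
    also have "\<psi> n q H ^ e S \<le> (1 + \<epsilon>) powr (- (q * real (e H))) * p ^ e S"
    proof -
      have "(1 + \<epsilon>) powr (q * real (e H)) * \<psi> n q H ^ e S \<le> (1 + \<epsilon>) powr real (e S) * \<psi> n q H ^ e S"
        using S(2) \<epsilon> \<psi>(1) by (intro mult_right_mono powr_mono) auto
      also have "\<dots> = ((1 + \<epsilon>) * \<psi> n q H) ^ e S"
        using \<epsilon> by (simp add: powr_realpow power_mult_distrib)
      also have "\<dots> \<le> p ^ e S" using p(2) \<psi>(1) \<epsilon> by (intro power_mono) auto
      finally show ?thesis using \<epsilon> by (simp add: powr_minus field_simps)
    qed
    finally show "1 \<le> (1 + \<epsilon>) powr (- (q * real (e H))) * p ^ e S * real n ^ v S"
      using mult_right_mono by fastforce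
  qed (use p p0 in auto)
  then show ?thesis by (simp add: growth_def mult_ac)
qed

text \<open>For the maximizer \<open>K\<close> of \<open>\<psi>\<close>, each of the \<open>e K - e S\<close> missing edges contributes a factor \<open>1 - \<epsilon>\<close>. What is
lost is the amount \<open>\<Theta>\<close> by which \<open>\<psi> ^ e S * n ^ v S\<close> may fall short of 1.\<close>

lemma overlap_below_threshold:
  assumes H: "simple_graph H" "v H \<le> n" "1 \<le> e H" and n: "n \<ge> 1"
    and q: "q \<le> 1" and p: "p \<in> {0..1}" "p \<le> (1 - \<epsilon>) * \<psi> n q H"
    and \<epsilon>: "0 < \<epsilon>" "\<epsilon> < 1" and \<Theta>: "\<Theta> \<ge> 0"
    and key: "\<And>S. subgraph S H \<Longrightarrow> real (e S) < t \<Longrightarrow> 1 \<le> \<Theta> * \<psi> n q H ^ e S * real n ^ v S"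
  shows "overlap_prob n H p (\<lambda>k. real k < t) \<le> (1 - \<epsilon>) powr (q * real (e H) - t) * \<Theta> * growth H"
proof -
  note \<psi> = \<psi>_bounds[OF H q]
  obtain K where K: "K \<in> large_subgraphs q H" "\<psi> n q H ^ e K * real n ^ v K \<le> real (v H) ^ (2 * v H)"
    by (rule \<psi>_maximizer[OF H q])
  note D = large_subgraphsD[OF K(1) H(1)]
  let ?r = "(1 - \<epsilon>) powr (q * real (e H) - t) * \<Theta> * real (v H) ^ (2 * v H)"
  have "overlap_prob n H p (\<lambda>k. real k < t) \<le> ?r * (real (v H) + 1) ^ v H"
  proof (rule small_overlap_unlikely[OF p(1) H(1,2) n D(5)])
    show "?r \<ge> 0" using \<Theta> by simp
    fix S assume S: "subgraph S H" "e S \<le> e K" "real (e S) < t"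
    have "p ^ (e K - e S) \<le> ((1 - \<epsilon>) * \<psi> n q H) ^ (e K - e S)"
      using p by (intro power_mono) auto
    also have "\<dots> = (1 - \<epsilon>) powr real (e K - e S) * \<psi> n q H ^ (e K - e S)"
      using \<epsilon> by (simp add: powr_realpow power_mult_distrib)
    also have "\<dots> \<le> (1 - \<epsilon>) powr (q * real (e H) - t) * \<psi> n q H ^ (e K - e S)"
      using \<epsilon> \<psi>(1) S(2,3) D(4) by (intro mult_right_mono powr_mono') (auto simp: of_nat_diff)
    finally have "p ^ (e K - e S) * real n ^ v K \<le> (1 - \<epsilon>) powr (q * real (e H) - t) * (\<psi> n q H ^ (e K - e S) * real n ^ v K)"
      by (simp add: mult_right_mono flip: mult.assoc)
    moreover have "\<psi> n q H ^ (e K - e S) * real n ^ v K \<le> \<Theta> * real n ^ v S * real (v H) ^ (2 * v H)"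
    proof -
      have "\<psi> n q H ^ (e K - e S) * real n ^ v K \<le>
      (\<psi> n q H ^ (e K - e S) * real n ^ v K) * (\<Theta> * \<psi> n q H ^ e S * real n ^ v S)"
      using mult_left_mono[OF key[OF S(1,3)], of "\<psi> n q H ^ (e K - e S) * real n ^ v K"] \<psi>(1) by simp
    also have "\<dots> = \<Theta> * real n ^ v S * (\<psi> n q H ^ e K * real n ^ v K)"
      using S(2) by (simp add: mult_ac flip: power_add)
    also have "\<dots> \<le> \<Theta> * real n ^ v S * real (v H) ^ (2 * v H)"
      using K(2) \<Theta> by (intro mult_left_mono) auto
      finally show ?thesis .
    qed
    ultimately have "p ^ (e K - e S) * real n ^ v K
      \<le> (1 - \<epsilon>) powr (q * real (e H) - t) * (\<Theta> * real n ^ v S * real (v H) ^ (2 * v H))"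
      by (meson mult_left_mono order_trans powr_ge_zero)
    then show "p ^ (e K - e S) * real n ^ v K \<le> ?r * real n ^ v S"
      by (simp add: mult_ac)
  qed
  then show ?thesis by (simp add: growth_def mult_ac)
qed

section \<open>Dense sequences\<close>

locale dense_planted_sequence =
  fixes H :: "nat \<Rightarrow> 'a ugraph"
  assumes graphs: "\<And>n. n \<ge> 1 \<Longrightarrow> simple_graph (H n)"
    and fits: "\<And>n. n \<ge> 1 \<Longrightarrow> v (H n) \<le> n"
    and dense: "sufficiently_dense H"
begin

abbreviation "m n \<equiv> real (e (H n))"

lemma filterlim_vertices: "filterlim (\<lambda>n. real (v (H n))) at_top sequentially"
  and filterlim_density: "filterlim (\<lambda>n. m n / (real (v (H n)) * ln (real (v (H n))))) at_top sequentially"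
  using dense by (auto simp: sufficiently_dense_def)

lemma eventually_edges_ge_vertices:
  assumes "A > 0"
  shows "eventually (\<lambda>n. real (v (H n)) \<ge> 3 \<and> A * (real (v (H n)) * ln (real (v (H n)))) \<le> m n) sequentially"
proof -
  have "eventually (\<lambda>n. 3 \<le> real (v (H n))) sequentially" "eventually (\<lambda>n. A \<le> m n / (real (v (H n)) * ln (real (v (H n))))) sequentially"
    using filterlim_vertices filterlim_density unfolding filterlim_at_top by blast+
  then show ?thesis
  proof eventually_elim
    case (elim n)
    then have "0 < real (v (H n)) * ln (real (v (H n)))" by simp
    then show ?case using elim by (simp add: pos_le_divide_eq)
  qed
qed

lemma filterlim_edges: "filterlim m at_top sequentially"
proof (rule filterlim_at_top_mono[OF filterlim_vertices])
  show "eventually (\<lambda>n. real (v (H n)) \<le> m n) sequentially"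
    using eventually_edges_ge_vertices[OF zero_less_one]
  proof eventually_elim
    case (elim n)
    then have "1 \<le> ln (real (v (H n)))"
      using exp_le by (subst ln_ge_iff) auto
    then have "real (v (H n)) * 1 \<le> real (v (H n)) * ln (real (v (H n)))" by (intro mult_left_mono) auto
    then show ?case using elim by linarith
  qed
qed

lemma eventually_graph:
  "eventually (\<lambda>n. 2 \<le> n \<and> simple_graph (H n) \<and> v (H n) \<le> n \<and> 1 \<le> e (H n)) sequentially"
proof -
  have "eventually (\<lambda>n. 1 \<le> m n) sequentially" using filterlim_edges unfolding filterlim_at_top by blast
  then show ?thesis using eventually_ge_at_top[of 2]
    by eventually_elim (use graphs fits in auto)
qed

lemma eventually_growth_le_exp:
  assumes "\<kappa> > 0"
  shows "eventually (\<lambda>n. growth (H n) \<le> exp (\<kappa> * m n)) sequentially"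
  using eventually_edges_ge_vertices[of "4 / \<kappa>"] assms
proof (simp, elim eventually_mono)
  fix n assume n: "3 \<le> v (H n) \<and> 4 * (real (v (H n)) * ln (real (v (H n)))) / \<kappa> \<le> m n"
  let ?v = "real (v (H n))"
  have v: "?v \<ge> 3" using n by simp
  have "3 * ?v \<le> ?v * ?v" using v by (intro mult_right_mono) auto
  then have "?v + 1 \<le> ?v ^ 2" using v by (simp only: power2_eq_square)
  then have "(?v + 1) ^ v (H n) \<le> (?v ^ 2) ^ v (H n)" by (intro power_mono) auto
  then have "growth (H n) \<le> ?v ^ (2 * v (H n)) * ?v ^ (2 * v (H n))"
    unfolding growth_def by (intro mult_right_mono) (simp_all add: power_mult)
  also have "\<dots> = ?v ^ (4 * v (H n))" by (simp flip: power_add)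
  also have "\<dots> = exp (4 * (?v * ln ?v))"
    using v by (simp add: powr_def mult_ac flip: powr_realpow)
  also have "\<dots> \<le> exp (\<kappa> * m n)" using n assms by (simp add: field_simps)
  finally show "growth (H n) \<le> exp (\<kappa> * m n)" .
qed

lemma eventually_exp_growth_small:
  assumes "c > 0" "\<delta> > 0"
  shows "eventually (\<lambda>n. exp (- c * m n) * growth (H n) \<le> \<delta>) sequentially"
proof -
  have "eventually (\<lambda>n. - ln \<delta> / (c / 2) \<le> m n) sequentially"
    using filterlim_edges unfolding filterlim_at_top by blast
  moreover have "eventually (\<lambda>n. growth (H n) \<le> exp (c / 2 * m n)) sequentially"
    using eventually_growth_le_exp[of "c / 2"] assms by simp
  ultimately show ?thesis
  proof eventually_elim
    fix n assume n: "- ln \<delta> / (c / 2) \<le> m n" and g: "growth (H n) \<le> exp (c / 2 * m n)"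
    have "exp (- c * m n) * growth (H n) \<le> exp (- c * m n) * exp (c / 2 * m n)"
      using g by (intro mult_left_mono) auto
    also have "\<dots> = exp (- (c * m n / 2))" by (simp flip: exp_add)
    also have "\<dots> \<le> exp (ln \<delta>)" using n assms by (subst exp_le_cancel_iff) (simp add: field_simps)
    finally show "exp (- c * m n) * growth (H n) \<le> \<delta>" using assms by simp
  qed
qed

text \<open>The gain \<open>(1 + \<epsilon>) powr (- q * m n)\<close> is exponential in the number of edges and so beats the
subexponential loss \<open>growth\<close>.\<close>

lemma MMSE_above_threshold:
  assumes q: "0 < q" "q \<le> 1" and \<epsilon>: "\<epsilon> > 0" and \<delta>: "\<delta> > 0"
  shows "eventually (\<lambda>n. \<forall>p\<in>{0..1}. (1 + \<epsilon>) * \<psi> n q (H n) \<le> p \<longrightarrow>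
    1 - q - \<delta> \<le> MMSE n (H n) p / m n) sequentially"
proof -
  have "q * ln (1 + \<epsilon>) > 0" "(\<delta> / 2)\<^sup>2 > 0" using q \<epsilon> \<delta> by auto
  from eventually_exp_growth_small[OF this] eventually_graph show ?thesis
  proof eventually_elim
    case (elim n)
    show ?case
    proof (intro ballI impI)
      fix p :: real assume p: "p \<in> {0..1}" "(1 + \<epsilon>) * \<psi> n q (H n) \<le> p"
      let ?P = "overlap_prob n (H n) p (\<lambda>k. q * m n \<le> real k)"
      have mp: "m n > 0" using elim by simp
      have "?P \<le> \<delta> / 2 + (1 + \<epsilon>) powr (- (q * m n)) * growth (H n) / (\<delta> / 2)"
        by (rule overlap_above_threshold) (use elim p q \<epsilon> \<delta> in auto)
      also have "(1 + \<epsilon>) powr (- (q * m n)) = exp (- (q * ln (1 + \<epsilon>)) * m n)"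
        using \<epsilon> by (simp add: powr_def)
      also have "\<delta> / 2 + exp (- (q * ln (1 + \<epsilon>)) * m n) * growth (H n) / (\<delta> / 2) \<le> \<delta> / 2 + (\<delta> / 2)\<^sup>2 / (\<delta> / 2)"
        using elim(1) \<delta> by (intro add_left_mono divide_right_mono) auto
      also have "\<dots> = \<delta>" using \<delta> by (simp add: power2_eq_square)
      finally have P: "?P \<le> \<delta>" .
      have "m n - q * m n - m n * ?P \<le> MMSE n (H n) p"
        by (rule MMSE_lower) (use elim p q copies_nonempty[of "H n" n] in auto)
      moreover have "m n * ?P \<le> m n * \<delta>" using P by (intro mult_left_mono) auto
      ultimately have "(1 - q - \<delta>) * m n \<le> MMSE n (H n) p" by (simp add: algebra_simps)
      then show "1 - q - \<delta> \<le> MMSE n (H n) p / m n" using mp by (simp add: pos_le_divide_eq)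
    qed
  qed
qed

text \<open>Below the threshold the replicas share a fraction \<open>\<tau>\<close> of the edges, as soon as the deficit
\<open>exp (\<theta> * m n)\<close> of the small intersections is less than the gain \<open>(1 - \<epsilon>) ^ ((q - \<tau>) * m n)\<close> from the
edges of the maximizer that an intersection of size \<open>\<tau> * m n\<close> leaves uncovered.\<close>

lemma MMSE_below_threshold:
  assumes q: "0 < q" "q \<le> 1" and \<epsilon>: "0 < \<epsilon>" "\<epsilon> < 1" and \<delta>: "\<delta> > 0"
    and \<tau>: "0 \<le> \<tau>" "\<tau> \<le> 1" and slack: "\<theta> < - ln (1 - \<epsilon>) * (q - \<tau>)"
    and key: "eventually (\<lambda>n. \<forall>S. subgraph S (H n) \<longrightarrow> 1 \<le> e S \<longrightarrow> real (e S) < \<tau> * m n \<longrightarrow>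
      1 \<le> exp (\<theta> * m n) * \<psi> n q (H n) ^ e S * real n ^ v S) sequentially"
    and \<theta>: "\<theta> \<ge> 0"
  shows "eventually (\<lambda>n. \<forall>p\<in>{0..1}. p \<le> (1 - \<epsilon>) * \<psi> n q (H n) \<longrightarrow>
    MMSE n (H n) p / m n \<le> 1 - \<tau> + \<delta>) sequentially"
proof -
  have "- ln (1 - \<epsilon>) * (q - \<tau>) - \<theta> > 0" using slack by simp
  from eventually_exp_growth_small[OF this \<delta>] eventually_graph key show ?thesis
  proof eventually_elim
    case (elim n)
    show ?case
    proof (intro ballI impI)
      fix p :: real assume p: "p \<in> {0..1}" "p \<le> (1 - \<epsilon>) * \<psi> n q (H n)"
      let ?P = "overlap_prob n (H n) p (\<lambda>k. real k < \<tau> * m n)"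
      have mp: "m n > 0" using elim by simp
      have "?P \<le> (1 - \<epsilon>) powr (q * m n - \<tau> * m n) * exp (\<theta> * m n) * growth (H n)"
      proof (rule overlap_below_threshold)
        fix S assume S: "subgraph S (H n)" "real (e S) < \<tau> * m n"
        show "1 \<le> exp (\<theta> * m n) * \<psi> n q (H n) ^ e S * real n ^ v S"
        proof (cases "e S = 0")
          case True
          have "1 * 1 \<le> exp (\<theta> * m n) * real n ^ v S" using elim \<theta> by (intro mult_mono) auto
          then show ?thesis using True by simp
        next
          case False
          then have "1 \<le> e S" by simp
          then show ?thesis using elim(3) S by blast
        qed
      qed (use elim p q \<epsilon> in auto)
      also have "(1 - \<epsilon>) powr (q * m n - \<tau> * m n) * exp (\<theta> * m n)
        = exp (- (- ln (1 - \<epsilon>) * (q - \<tau>) - \<theta>) * m n)"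
        using \<epsilon> by (simp add: powr_def algebra_simps flip: exp_add)
      also have "\<dots> * growth (H n) \<le> \<delta>" by (rule elim(1))
      finally have P: "?P \<le> \<delta>" .
      have "\<tau> * m n \<le> 1 * m n" using \<tau> by (intro mult_right_mono) auto
      then have "MMSE n (H n) p \<le> m n - \<tau> * m n + m n * ?P"
        by (intro MMSE_upper) (use elim p \<tau> copies_nonempty[of "H n" n] in auto)
      moreover have "m n * ?P \<le> m n * \<delta>" using P by (intro mult_left_mono) auto
      ultimately have "MMSE n (H n) p \<le> (1 - \<tau> + \<delta>) * m n" by (simp add: algebra_simps)
      then show "MMSE n (H n) p / m n \<le> 1 - \<tau> + \<delta>" using mp by (simp add: pos_divide_le_eq)
    qed
  qed
qed

lemma eventually_ratio_le:
  assumes ratio: "(\<lambda>n. \<psi> n q (H n) / \<psi> n q' (H n)) \<longlonglongrightarrow> 1" and q': "q' \<le> 1" and x: "x > 1"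
  shows "eventually (\<lambda>n. \<psi> n q (H n) \<le> x * \<psi> n q' (H n)) sequentially"
  using order_tendstoD(2)[OF ratio x] eventually_graph
proof eventually_elim
  case (elim n)
  then have "0 < \<psi> n q' (H n)" using \<psi>_bounds(1) q' by blast
  then show ?case using elim(1) by (simp add: pos_divide_less_eq less_imp_le)
qed

end

locale delocalized_sequence = dense_planted_sequence +
  fixes q0 C :: real
  assumes q0: "0 < q0" "q0 \<le> 1" and C: "C \<ge> 0"
    and deloc: "\<And>n. n \<ge> 2 \<Longrightarrow> \<alpha> q0 (H n) \<le> \<alpha> 0 (H n) + C / ln (real n)"
begin

text \<open>With delocalization, an intersection with at most \<open>\<tau> * m n\<close> edges has the deficit
\<open>exp (C * \<tau> * m n)\<close>, which is small compared with \<open>(1 - \<epsilon>) ^ ((q - \<tau>) * m n)\<close> if \<open>\<tau>\<close> is small.\<close>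

lemma MMSE_below_threshold_nontrivial:
  assumes q: "0 < q" "q \<le> q0" and \<epsilon>: "0 < \<epsilon>" "\<epsilon> < 1"
  obtains c where "c > 0" "eventually (\<lambda>n. \<forall>p\<in>{0..1}. p \<le> (1 - \<epsilon>) * \<psi> n q (H n) \<longrightarrow>
    MMSE n (H n) p / m n \<le> 1 - c) sequentially"
proof -
  define l where "l = - ln (1 - \<epsilon>)"
  have l: "l > 0" using \<epsilon> by (simp add: l_def)
  \<comment> \<open>chosen so that the deficit C * \<tau> falls short of the gain l * (q - \<tau>) by l * q / 2\<close>
  define \<tau> where "\<tau> = l * q / (2 * (C + l))"
  have Cl: "C + l > 0" using C l by simp
  have \<tau>0: "\<tau> > 0" using l q C by (simp add: \<tau>_def)
  have \<tau>e: "2 * (C + l) * \<tau> = l * q" using Cl by (simp add: \<tau>_def)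
  have "l * q = 2 * (C * \<tau>) + 2 * (l * \<tau>)" using \<tau>e by (simp add: algebra_simps)
  moreover have "0 \<le> C * \<tau>" "0 \<le> l * \<tau>" using C \<tau>0 l by auto
  ultimately have "l * \<tau> \<le> l * q" by linarith
  then have \<tau>q: "\<tau> \<le> q" using l by simp
  have q1: "q \<le> 1" using q q0 by simp
  have "l * q > 0" using l q by simp
  then have slack: "C * \<tau> < l * (q - \<tau>)" using \<tau>e by (simp add: algebra_simps)
  have "eventually (\<lambda>n. \<forall>p\<in>{0..1}. p \<le> (1 - \<epsilon>) * \<psi> n q (H n) \<longrightarrow>
    MMSE n (H n) p / m n \<le> 1 - \<tau> + \<tau> / 2) sequentially"
  proof (rule MMSE_below_threshold)
    show "eventually (\<lambda>n. \<forall>S. subgraph S (H n) \<longrightarrow> 1 \<le> e S \<longrightarrow> real (e S) < \<tau> * m n \<longrightarrow>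
      1 \<le> exp (C * \<tau> * m n) * \<psi> n q (H n) ^ e S * real n ^ v S) sequentially"
      using eventually_graph
    proof eventually_elim
      case (elim n)
      show ?case
      proof (intro allI impI)
        fix S assume S: "subgraph S (H n)" "1 \<le> e S" "real (e S) < \<tau> * m n"
        have "1 \<le> exp (C * real (e S)) * \<psi> n q (H n) ^ e S * real n ^ v S"
          using \<psi>_power_ge_delocalized[of "H n" n q q0 C S] elim q q0 deloc S by auto
        also have "\<dots> \<le> exp (C * \<tau> * m n) * \<psi> n q (H n) ^ e S * real n ^ v S"
        proof -
          have "C * real (e S) \<le> C * (\<tau> * m n)" using S(3) C by (intro mult_left_mono) auto
          moreover have "0 < \<psi> n q (H n)" using elim q1 \<psi>_bounds(1) by blast
          ultimately show ?thesis by (intro mult_right_mono) (auto simp: mult.assoc)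
        qed
        finally show "1 \<le> exp (C * \<tau> * m n) * \<psi> n q (H n) ^ e S * real n ^ v S" .
      qed
    qed
  qed (use q q1 \<epsilon> \<tau>0 \<tau>q slack C in \<open>auto simp: l_def\<close>)
  then show ?thesis using that[of "\<tau> / 2"] \<tau>0 by simp
qed

text \<open>For \<open>q\<close> close to 1, intersections of almost full size are excluded only if there is hardly any
deficit. For those with at least \<open>q' * m n\<close> edges, comparing \<open>\<psi>_q\<close> with \<open>\<psi>_q'\<close> costs
\<open>exp (\<eta> * m n)\<close>; for the others, delocalization costs a further \<open>exp (C * q' * m n)\<close>. Both exponents
can be made arbitrarily small multiples of \<open>m n\<close>.\<close>

lemma MMSE_below_constant_threshold:
  assumes q: "1/2 < q" "q < 1" and \<epsilon>: "0 < \<epsilon>" "\<epsilon> < 1" and \<delta>: "\<delta> > 0"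
    and ratio: "\<And>q'. q' \<in> {0<..<1} \<Longrightarrow> (\<lambda>n. \<psi> n q' (H n) / \<psi> n q (H n)) \<longlonglongrightarrow> 1"
  shows "eventually (\<lambda>n. \<forall>p\<in>{0..1}. p \<le> (1 - \<epsilon>) * \<psi> n q (H n) \<longrightarrow>
    MMSE n (H n) p / m n \<le> 2 * (1 - q) + \<delta>) sequentially"
proof -
  define l where "l = - ln (1 - \<epsilon>)"
  have l: "l > 0" using \<epsilon> by (simp add: l_def)
  \<comment> \<open>a quarter of the gain from the edges that an intersection of size (2 * q - 1) * m n leaves uncovered\<close>
  define \<eta> where "\<eta> = l * (1 - q) / 4"
  have \<eta>: "\<eta> > 0" using l q by (simp add: \<eta>_def)
  define q' where "q' = min (q0 / 2) (\<eta> / (C + 1))"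
  have "0 < q'" "q' \<le> q0 / 2" unfolding q'_def using q0 \<eta> C by (simp, intro min.cobounded1)
  then have q': "0 < q'" "q' < 1" "q' \<le> q0" using q0 by auto
  have "q' \<le> \<eta> / (C + 1)" by (simp add: q'_def)
  then have "q' * (C + 1) \<le> \<eta>" using C by (simp add: pos_le_divide_eq)
  then have Cq': "C * q' \<le> \<eta>" using q'(1) by (simp add: algebra_simps)
  have "(\<lambda>n. \<psi> n q' (H n) / \<psi> n q (H n)) \<longlonglongrightarrow> 1" using ratio q' by simp
  from eventually_ratio_le[OF this, of "exp \<eta>"] q \<eta>
  have cmp: "eventually (\<lambda>n. \<psi> n q' (H n) \<le> exp \<eta> * \<psi> n q (H n)) sequentially" by simp
  have "eventually (\<lambda>n. \<forall>p\<in>{0..1}. p \<le> (1 - \<epsilon>) * \<psi> n q (H n) \<longrightarrow>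
    MMSE n (H n) p / m n \<le> 1 - (2 * q - 1) + \<delta>) sequentially"
  proof (rule MMSE_below_threshold)
    show "2 * \<eta> < - ln (1 - \<epsilon>) * (q - (2 * q - 1))"
    proof -
      have "l * (1 - q) > 0" using l q by simp
      then have "2 * \<eta> < l * (1 - q)" by (simp add: \<eta>_def)
      then show ?thesis by (simp add: l_def algebra_simps)
    qed
    show "eventually (\<lambda>n. \<forall>S. subgraph S (H n) \<longrightarrow> 1 \<le> e S \<longrightarrow> real (e S) < (2 * q - 1) * m n \<longrightarrow>
      1 \<le> exp (2 * \<eta> * m n) * \<psi> n q (H n) ^ e S * real n ^ v S) sequentially"
      using eventually_graph cmp
    proof eventually_elim
      case (elim n)
      have \<psi>': "0 < \<psi> n q' (H n)" using elim q' \<psi>_bounds(1)[of "H n" n q'] by auto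
      show ?case
      proof (intro allI impI)
        fix S assume S: "subgraph S (H n)" "1 \<le> e S" "real (e S) < (2 * q - 1) * m n"
        have "(2 * q - 1) * m n \<le> 1 * m n" using q by (intro mult_right_mono) auto
        then have eS: "real (e S) \<le> m n" using S(3) by simp
        have "1 \<le> exp (\<eta> * m n) * \<psi> n q' (H n) ^ e S * real n ^ v S"
        proof (cases "q' * m n \<le> real (e S)")
          case True
          then have "S \<in> large_subgraphs q' (H n)" using S by (simp add: large_subgraphs_def)
          then have "1 \<le> \<psi> n q' (H n) ^ e S * real n ^ v S" using \<psi>_power_ge elim by blast
          then have "1 * 1 \<le> exp (\<eta> * m n) * (\<psi> n q' (H n) ^ e S * real n ^ v S)"
            using \<eta> by (intro mult_mono) auto
          then show ?thesis by (simp add: mult.assoc)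
        next
          case False
          have "1 \<le> exp (C * real (e S)) * \<psi> n q' (H n) ^ e S * real n ^ v S"
            using \<psi>_power_ge_delocalized[of "H n" n q' q0 C S] elim q' q0 deloc S by auto
          also have "\<dots> \<le> exp (\<eta> * m n) * \<psi> n q' (H n) ^ e S * real n ^ v S"
          proof -
            have "C * real (e S) \<le> C * (q' * m n)" using False C by (intro mult_left_mono) auto
            also have "\<dots> \<le> \<eta> * m n" using mult_right_mono[OF Cq', of "m n"] by (simp add: mult.assoc)
            finally show ?thesis using \<psi>' by (intro mult_right_mono) auto
          qed
          finally show ?thesis .
        qed
        also have "\<dots> \<le> exp (\<eta> * m n) * (exp (\<eta> * m n) * \<psi> n q (H n) ^ e S) * real n ^ v S"
        proof (intro mult_right_mono mult_left_mono)
          have "\<psi> n q' (H n) ^ e S \<le> (exp \<eta> * \<psi> n q (H n)) ^ e S"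
            using elim \<psi>' by (intro power_mono) auto
          also have "\<dots> = exp (\<eta> * real (e S)) * \<psi> n q (H n) ^ e S"
            by (simp add: power_mult_distrib mult.commute flip: exp_of_nat_mult)
          also have "\<dots> \<le> exp (\<eta> * m n) * \<psi> n q (H n) ^ e S"
            using eS \<eta> elim q \<psi>_bounds(1)[of "H n" n q] by (intro mult_right_mono) auto
          finally show "\<psi> n q' (H n) ^ e S \<le> exp (\<eta> * m n) * \<psi> n q (H n) ^ e S" .
        qed auto
        also have "\<dots> = exp (2 * \<eta> * m n) * \<psi> n q (H n) ^ e S * real n ^ v S"
          by (simp flip: exp_add)
        finally show "1 \<le> exp (2 * \<eta> * m n) * \<psi> n q (H n) ^ e S * real n ^ v S" .
      qed
    qed
  qed (use q \<epsilon> \<delta> \<eta> in auto)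
  then show ?thesis by (simp add: algebra_simps)
qed

section \<open>All-or-nothing\<close>

text \<open>Any \<open>q\<close> in the open unit interval could replace \<open>1/2\<close>. The value for graphs without edges,
for which \<open>\<psi>\<close> is a maximum over the empty set, only serves to stay in the unit interval.\<close>

lemma AoN_critical_\<psi>:
  assumes ratio: "\<And>q q'. q \<in> {0<..<1} \<Longrightarrow> q' \<in> {0<..<1} \<Longrightarrow>
    (\<lambda>n. \<psi> n q (H n) / \<psi> n q' (H n)) \<longlonglongrightarrow> 1"
  shows "AoN_critical H (\<lambda>n. if 1 \<le> e (H n) then \<psi> n (1/2) (H n) else 0)"
    (is "AoN_critical H ?pA")
  unfolding AoN_critical_def
proof (intro conjI allI impI)
  fix n :: nat assume "1 \<le> n"
  then show "?pA n \<in> {0..1}"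
    using \<psi>_bounds[OF graphs fits, where q = "1/2"] by (auto simp: less_imp_le)
next
  fix \<epsilon> :: real and p :: "nat \<Rightarrow> real"
  assume \<epsilon>: "\<epsilon> > 0" and p: "\<forall>n\<ge>1. p n \<in> {0..1}"
  let ?r = "\<lambda>n. MMSE n (H n) (p n) / m n"
  show "(?r \<longlongrightarrow> 1) (inf sequentially (principal {n. (1 + \<epsilon>) * ?pA n \<le> p n}))"
  proof (rule tendstoI)
    fix \<delta> :: real assume \<delta>: "\<delta> > 0"
    define q where "q = min (\<delta> / 4) (1 / 2)"
    have q: "0 < q" "q < 1" "q \<le> \<delta> / 4" using \<delta> by (auto simp: q_def)
    define x where "x = (1 + \<epsilon>) / (1 + \<epsilon> / 2)"
    have x: "x > 1" "(1 + \<epsilon> / 2) * x = 1 + \<epsilon>" using \<epsilon> by (auto simp: x_def)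
    have cmp: "eventually (\<lambda>n. \<psi> n q (H n) \<le> x * \<psi> n (1/2) (H n)) sequentially"
      using q x by (intro eventually_ratio_le ratio) auto
    have above: "eventually (\<lambda>n. \<forall>p\<in>{0..1}. (1 + \<epsilon> / 2) * \<psi> n q (H n) \<le> p \<longrightarrow>
      1 - q - \<delta> / 4 \<le> MMSE n (H n) p / m n) sequentially"
      using q \<epsilon> \<delta> by (intro MMSE_above_threshold) auto
    show "eventually (\<lambda>n. dist (?r n) 1 < \<delta>) (inf sequentially (principal {n. (1 + \<epsilon>) * ?pA n \<le> p n}))"
      unfolding eventually_inf_principal using cmp above eventually_graph
    proof eventually_elim
      case (elim n)
      show ?case
      proof
        assume "n \<in> {n. (1 + \<epsilon>) * ?pA n \<le> p n}"
        then have "(1 + \<epsilon>) * \<psi> n (1/2) (H n) \<le> p n" using elim by simp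
        moreover have "(1 + \<epsilon> / 2) * \<psi> n q (H n) \<le> (1 + \<epsilon> / 2) * (x * \<psi> n (1/2) (H n))"
          using elim(1) \<epsilon> by (intro mult_left_mono) auto
        ultimately have "(1 + \<epsilon> / 2) * \<psi> n q (H n) \<le> p n"
          using x(2) by (simp flip: mult.assoc)
        then have "1 - q - \<delta> / 4 \<le> ?r n" using elim p by auto
        moreover have "?r n \<le> 1"
          using elim p MMSE_le(2)[of "p n" n "H n"] copies_nonempty[of "H n" n] by (auto simp: divide_le_eq)
        ultimately show "dist (?r n) 1 < \<delta>" using q \<delta> by (simp add: dist_real_def)
      qed
    qed
  qed
  show "(?r \<longlongrightarrow> 0) (inf sequentially (principal {n. p n \<le> (1 - \<epsilon>) * ?pA n}))"
  proof (rule tendstoI)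
    fix \<delta> :: real assume \<delta>: "\<delta> > 0"
    define \<epsilon>' where "\<epsilon>' = min \<epsilon> (1 / 2)"
    have \<epsilon>': "0 < \<epsilon>'" "\<epsilon>' \<le> 1/2" "\<epsilon>' \<le> \<epsilon>" using \<epsilon> by (auto simp: \<epsilon>'_def)
    define q where "q = max (3/4) (1 - \<delta> / 8)"
    have q: "1/2 < q" "q < 1" "2 * (1 - q) \<le> \<delta> / 4" using \<delta> by (auto simp: q_def max_def)
    define x where "x = (1 - \<epsilon>' / 2) / (1 - \<epsilon>')"
    have x: "x > 1" "(1 - \<epsilon>') * x = 1 - \<epsilon>' / 2" using \<epsilon>' by (auto simp: x_def)
    have cmp: "eventually (\<lambda>n. \<psi> n (1/2) (H n) \<le> x * \<psi> n q (H n)) sequentially"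
      using q x by (intro eventually_ratio_le ratio) auto
    have below: "eventually (\<lambda>n. \<forall>p\<in>{0..1}. p \<le> (1 - \<epsilon>' / 2) * \<psi> n q (H n) \<longrightarrow>
      MMSE n (H n) p / m n \<le> 2 * (1 - q) + \<delta> / 4) sequentially"
      using q \<epsilon>' \<delta> by (intro MMSE_below_constant_threshold ratio) auto
    show "eventually (\<lambda>n. dist (?r n) 0 < \<delta>) (inf sequentially (principal {n. p n \<le> (1 - \<epsilon>) * ?pA n}))"
      unfolding eventually_inf_principal using cmp below eventually_graph
    proof eventually_elim
      case (elim n)
      show ?case
      proof
        assume "n \<in> {n. p n \<le> (1 - \<epsilon>) * ?pA n}"
        then have "p n \<le> (1 - \<epsilon>) * \<psi> n (1/2) (H n)" using elim by simp
        also have "\<dots> \<le> (1 - \<epsilon>') * \<psi> n (1/2) (H n)"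
          using \<epsilon>' elim \<psi>_bounds(1)[of "H n" n "1/2"] by (intro mult_right_mono) auto
        also have "\<dots> \<le> (1 - \<epsilon>') * (x * \<psi> n q (H n))"
          using elim(1) \<epsilon>' by (intro mult_left_mono) auto
        finally have "p n \<le> (1 - \<epsilon>' / 2) * \<psi> n q (H n)" using x(2) by (simp flip: mult.assoc)
        then have "?r n \<le> 2 * (1 - q) + \<delta> / 4" using elim p by auto
        moreover have "0 \<le> ?r n"
          using elim p MMSE_le(1)[of "p n" n "H n"] copies_nonempty[of "H n" n] by auto
        ultimately show "dist (?r n) 0 < \<delta>" using q \<delta> by (simp add: dist_real_def)
      qed
    qed
  qed
qed

text \<open>Apply the two regimes at \<open>p = (1 - \<epsilon>) * pA\<close>: if this were above \<open>(1 + \<epsilon>) * \<psi>_q\<close>, then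
\<open>MMSE_above_threshold\<close> would keep the error away from 0.\<close>

lemma AoN_critical_le:
  assumes crit: "AoN_critical H pA" and q: "0 < q" "q < 1" and \<epsilon>: "0 < \<epsilon>" "\<epsilon> < 1"
  shows "eventually (\<lambda>n. (1 - \<epsilon>) * pA n \<le> (1 + \<epsilon>) * \<psi> n q (H n)) sequentially"
proof -
  define p where "p = (\<lambda>n. (1 - \<epsilon>) * pA n)"
  have pA: "\<forall>n\<ge>1. pA n \<in> {0..1}" using crit by (simp add: AoN_critical_def)
  have p: "\<forall>n\<ge>1. p n \<in> {0..1}"
    using pA \<epsilon> by (auto simp: p_def intro!: mult_le_one)
  have "((\<lambda>n. MMSE n (H n) (p n) / m n) \<longlongrightarrow> 0) (inf sequentially (principal {n. p n \<le> (1 - \<epsilon>) * pA n}))"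
    using crit p \<epsilon> unfolding AoN_critical_def by blast
  then have lim: "(\<lambda>n. MMSE n (H n) (p n) / m n) \<longlonglongrightarrow> 0" by (simp add: p_def)
  have "(1 - q) / 2 > 0" using q by simp
  from order_tendstoD(2)[OF lim this]
    MMSE_above_threshold[OF q(1) less_imp_le[OF q(2)] \<epsilon>(1) this] eventually_ge_at_top[of 1]
  show ?thesis
  proof eventually_elim
    case (elim n)
    show ?case
    proof (rule ccontr)
      assume "\<not> ?thesis"
      then have "(1 + \<epsilon>) * \<psi> n q (H n) \<le> p n" by (simp add: p_def)
      then have "1 - q - (1 - q) / 2 \<le> MMSE n (H n) (p n) / m n" using elim p by auto
      then show False using elim(1) by (simp add: field_simps)
    qed
  qed
qed

text \<open>Apply the two regimes at \<open>p = (1 - \<epsilon>) * \<psi>_q1\<close>, with \<open>q1\<close> small enough for delocalization: if this were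
above \<open>(1 + \<epsilon>) * pA\<close>, then \<open>MMSE_below_threshold_nontrivial\<close> would keep the error away from 1. Passing from
\<open>q\<close> to the smaller \<open>q1\<close> only strengthens the bound, as \<open>\<psi>\<close> decreases in \<open>q\<close>.\<close>

lemma AoN_critical_ge:
  assumes crit: "AoN_critical H pA" and q: "0 < q" "q < 1" and \<epsilon>: "0 < \<epsilon>" "\<epsilon> < 1"
  shows "eventually (\<lambda>n. (1 - \<epsilon>) * \<psi> n q (H n) \<le> (1 + \<epsilon>) * pA n) sequentially"
proof -
  define q1 where "q1 = min q q0"
  have q1: "0 < q1" "q1 \<le> q0" "q1 \<le> q" using q q0 by (auto simp: q1_def)
  obtain c where c: "c > 0" "eventually (\<lambda>n. \<forall>p\<in>{0..1}. p \<le> (1 - \<epsilon>) * \<psi> n q1 (H n) \<longrightarrow>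
    MMSE n (H n) p / m n \<le> 1 - c) sequentially"
    by (rule MMSE_below_threshold_nontrivial[OF q1(1,2) \<epsilon>])
  define p where "p = (\<lambda>n. if 1 \<le> e (H n) then (1 - \<epsilon>) * \<psi> n q1 (H n) else 0)"
  have p: "\<forall>n\<ge>1. p n \<in> {0..1}"
    using \<psi>_bounds[OF graphs fits, where q = q1] q1 q \<epsilon>
    by (auto simp: p_def less_imp_le intro!: mult_le_one)
  have "((\<lambda>n. MMSE n (H n) (p n) / m n) \<longlongrightarrow> 1) (inf sequentially (principal {n. p n \<ge> (1 + \<epsilon>) * pA n}))"
    using crit p \<epsilon> unfolding AoN_critical_def by blast
  then have "eventually (\<lambda>n. n \<in> {n. p n \<ge> (1 + \<epsilon>) * pA n} \<longrightarrow> 1 - c < MMSE n (H n) (p n) / m n) sequentially"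
    unfolding eventually_inf_principal[symmetric] using c(1) by (intro order_tendstoD) auto
  then show ?thesis using c(2) eventually_graph
  proof eventually_elim
    case (elim n)
    have "(1 - \<epsilon>) * \<psi> n q1 (H n) \<le> (1 + \<epsilon>) * pA n"
    proof (rule ccontr)
      assume "\<not> ?thesis"
      then have "p n \<ge> (1 + \<epsilon>) * pA n" "p n \<le> (1 - \<epsilon>) * \<psi> n q1 (H n)" using elim by (auto simp: p_def)
      then have "1 - c < MMSE n (H n) (p n) / m n" "MMSE n (H n) (p n) / m n \<le> 1 - c"
        using elim p by auto
      then show False by simp
    qed
    moreover have "(1 - \<epsilon>) * \<psi> n q (H n) \<le> (1 - \<epsilon>) * \<psi> n q1 (H n)"
      using elim q q1 \<epsilon> \<psi>_antimono[of "H n" q1 q n] by (intro mult_left_mono) auto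
    ultimately show ?case by simp
  qed
qed

lemma AoN_critical_ratio:
  assumes crit: "AoN_critical H pA" and q: "0 < q" "q < 1"
  shows "(\<lambda>n. pA n / \<psi> n q (H n)) \<longlonglongrightarrow> 1"
proof (rule tendstoI)
  fix \<delta> :: real assume \<delta>: "\<delta> > 0"
  define \<epsilon> where "\<epsilon> = min (1/2) (\<delta> / 8)"
  have \<epsilon>: "0 < \<epsilon>" "\<epsilon> \<le> 1/2" "8 * \<epsilon> \<le> \<delta>" using \<delta> by (auto simp: \<epsilon>_def)
  then have \<epsilon>1: "\<epsilon> < 1" by simp
  show "eventually (\<lambda>n. dist (pA n / \<psi> n q (H n)) 1 < \<delta>) sequentially"
    using AoN_critical_le[OF crit q \<epsilon>(1) \<epsilon>1] AoN_critical_ge[OF crit q \<epsilon>(1) \<epsilon>1] eventually_graph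
  proof eventually_elim
    case (elim n)
    define r where "r = pA n / \<psi> n q (H n)"
    have \<psi>: "\<psi> n q (H n) > 0" using elim q \<psi>_bounds(1)[of "H n" n q] by auto
    \<comment> \<open>for \<epsilon> at most 1/2, the quotients of 1 + \<epsilon> and 1 - \<epsilon> differ from 1 by at most 4 * \<epsilon>\<close>
    have "(1 - \<epsilon>) * r \<le> 1 + \<epsilon>" "1 - \<epsilon> \<le> (1 + \<epsilon>) * r"
      using elim(1,2) \<psi> by (auto simp: r_def pos_le_divide_eq pos_divide_le_eq)
    then have "r \<le> 1 + 4 * \<epsilon>" "1 - 4 * \<epsilon> \<le> r"
    proof -
      assume a: "(1 - \<epsilon>) * r \<le> 1 + \<epsilon>" and b: "1 - \<epsilon> \<le> (1 + \<epsilon>) * r"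
      have "\<epsilon> * \<epsilon> \<le> \<epsilon> * (1/2)" using \<epsilon> by (intro mult_left_mono) auto
      then have "1 + \<epsilon> \<le> (1 - \<epsilon>) * (1 + 4 * \<epsilon>)" by (simp add: algebra_simps)
      then have "(1 - \<epsilon>) * r \<le> (1 - \<epsilon>) * (1 + 4 * \<epsilon>)" using a by simp
      then show "r \<le> 1 + 4 * \<epsilon>" using \<epsilon>1 by simp
      have "(1 + \<epsilon>) * (1 - 4 * \<epsilon>) \<le> 1 - \<epsilon>" using \<epsilon>(1) mult_nonneg_nonneg[of \<epsilon> \<epsilon>] by (simp add: algebra_simps)
      then have "(1 + \<epsilon>) * (1 - 4 * \<epsilon>) \<le> (1 + \<epsilon>) * r" using b by simp
      then show "1 - 4 * \<epsilon> \<le> r" using \<epsilon>(1) by simp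
    qed
    then show ?case using \<epsilon> by (simp add: r_def dist_real_def abs_le_iff)
  qed
qed

lemma AoN_critical_imp_constant_\<psi>:
  assumes crit: "AoN_critical H pA" and q: "0 < q" "q < 1" and q': "0 < q'" "q' < 1"
  shows "(\<lambda>n. \<psi> n q (H n) / \<psi> n q' (H n)) \<longlonglongrightarrow> 1"
proof -
  have lims: "(\<lambda>n. pA n / \<psi> n q' (H n)) \<longlonglongrightarrow> 1" "(\<lambda>n. pA n / \<psi> n q (H n)) \<longlonglongrightarrow> 1"
    by (rule AoN_critical_ratio[OF crit q'], rule AoN_critical_ratio[OF crit q])
  have "(\<lambda>n. (pA n / \<psi> n q' (H n)) / (pA n / \<psi> n q (H n))) \<longlonglongrightarrow> 1 / 1"
    by (intro tendsto_divide lims) simp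
  moreover have "eventually (\<lambda>n. (pA n / \<psi> n q' (H n)) / (pA n / \<psi> n q (H n)) = \<psi> n q (H n) / \<psi> n q' (H n)) sequentially"
    using order_tendstoD(1)[OF lims(2) zero_less_one]
    by eventually_elim (auto simp: field_simps)
  ultimately show ?thesis by (simp add: tendsto_cong)
qed

end

theorem theorem2p5:
  fixes H :: "nat \<Rightarrow> 'a ugraph"
  assumes graphs: "\<And>n. n \<ge> 1 \<Longrightarrow> simple_graph (H n)"
    and fits: "\<And>n. n \<ge> 1 \<Longrightarrow> v (H n) \<le> n"
    and dense: "sufficiently_dense H"
    and deloc: "delocalized H"
  shows "(exhibits_AoN H \<longleftrightarrow>
           (\<forall>q\<in>{0<..<1}. \<forall>q'\<in>{0<..<1}. (\<lambda>n. \<psi> n q (H n) / \<psi> n q' (H n)) \<longlonglongrightarrow> 1))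
       \<and> (\<forall>pA. AoN_critical H pA \<longrightarrow>
           (\<forall>q\<in>{0<..<1}. pA \<sim>[at_top] (\<lambda>n. \<psi> n q (H n))))"
proof -
  obtain q0 C where q0: "0 < q0" "q0 \<le> 1"
    and C: "\<And>n. n \<ge> 2 \<Longrightarrow> \<alpha> q0 (H n) \<le> \<alpha> 0 (H n) + C / ln (real n)"
    using deloc by (auto simp: delocalized_def)
  interpret delocalized_sequence H q0 "max C 0"
  proof
    fix n :: nat assume n: "n \<ge> 2"
    then have "C / ln (real n) \<le> max C 0 / ln (real n)" by (intro divide_right_mono) auto
    then show "\<alpha> q0 (H n) \<le> \<alpha> 0 (H n) + max C 0 / ln (real n)" using C[OF n] by simp
  qed (use graphs fits dense q0 in auto)
  show ?thesis
  proof (intro conjI allI impI ballI iffI)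
    fix q q' :: real assume "exhibits_AoN H" "q \<in> {0<..<1}" "q' \<in> {0<..<1}"
    then show "(\<lambda>n. \<psi> n q (H n) / \<psi> n q' (H n)) \<longlonglongrightarrow> 1"
      using AoN_critical_imp_constant_\<psi> by (auto simp: exhibits_AoN_def)
  next
    assume "\<forall>q\<in>{0<..<1}. \<forall>q'\<in>{0<..<1}. (\<lambda>n. \<psi> n q (H n) / \<psi> n q' (H n)) \<longlonglongrightarrow> 1"
    then show "exhibits_AoN H"
      unfolding exhibits_AoN_def using AoN_critical_\<psi> by blast
  next
    fix pA and q :: real assume "AoN_critical H pA" "q \<in> {0<..<1}"
    then show "pA \<sim>[at_top] (\<lambda>n. \<psi> n q (H n))"
      using AoN_critical_ratio by (intro asymp_equivI') auto
  qed
qed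

end
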